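(* Let $(Y,\mathcal{Y},\nu,S)$ be a measure-preserving system and let $\mathcal{E}=(E_n)_{n\in\mathbb{N}}$ be a sequence of measurable subsets of $Y$ such that: (1) $\mathcal{E}$ has decay of correlation against $L^1(\nu)$ with a rate $\rho\colon\mathbb{N}\to\mathbb{R}_+$ that is decreasing and summable ($\sum_{n\in\mathbb{N}}\rho(n)<+\infty$), and (2) there exist $a\in(0,1/2)$ and $c>0$ such that $\nu(E_n)=cn^{-a}$ for all $n\in\mathbb{N}$. Then, for $\nu$-almost every $y\in Y$, the sequence of return times $(r_n(y,\mathcal{E}))_{n\in\mathbb{N}}$ is pointwise universally $L^2$-good and ergodic. That is, for $\nu$-almost every $y\in Y$ the following holds: for every measure-preserving system $(X,\mathcal{X},\mu,T)$ and every $f\in L^2(\mu)$, $$\lim_{N\to\infty}\frac{1}{N}\sum_{n=1}^N f(T^{r_n(y,\mathcal{E})}x)=\mathbb{E}_\mu(f|\mathcal{I}(T))(x)$$ for $\mu$-almost every $x\in X$.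
   Context: $\mathbb{N}=\{1,2,3,\dots\}$ and $\mathbb{R}_+$ denotes the non-negative reals. A measure-preserving system $(X,\mathcal{X},\mu,T)$ is a probability space $(X,\mathcal{X},\mu)$ with a measurable map $T\colon X\to X$ (not assumed invertible) such that $\mu(T^{-1}A)=\mu(A)$ for all $A\in\mathcal{X}$. $\mathcal{I}(T)=\{A\in\mathcal{X}: T^{-1}A=A \bmod \mu\}$ is the $\sigma$-algebra of invariant sets and $\mathbb{E}_\mu(f|\mathcal{I}(T))$ is the conditional expectation. A sequence of integers $(a_n)_{n\in\mathbb{N}}$ is pointwise universally $L^p$-good if for every measure-preserving system $(X,\mathcal{X},\mu,T)$ and $f\in L^p(\mu)$ the averages $\frac1N\sum_{n=1}^N f(T^{a_n}x)$ converge for $\mu$-almost every $x\in X$. It is ergodic if for every measure-preserving system and every $f\in L^2(\mu)$ the $L^2(\mu)$-limit of these averages exists and equals $\mathbb{E}_\mu(f|\mathcal{I}(T))$. Return times: $r_1(y,\mathcal{E})=\inf\{k\in\mathbb{N}: S^ky\in E_k\}$ and, for $n>1$, $r_n(y,\mathcal{E})=\inf\{k>r_{n-1}(y,\mathcal{E}): S^ky\in E_k\}$; i.e. $(r_n(y,\mathcal{E}))_{n\in\mathbb{N}}$ enumerates $\{n\in\mathbb{N}: S^ny\in E_n\}$ in increasing order. The conclusion includes that this set is infinite for $\nu$-almost every $y$, so that the sequence is well defined. Decay of correlation: $\mathcal{E}=(E_n)_{n\in\mathbb{N}}$ has decay of correlation against $L^1(\nu)$ with rate $\rho\colon\mathbb{N}\to\mathbb{R}_+$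 if there exists $C>0$ such that $$\left|\int_{E_n} g\circ S^m\,d\nu-\nu(E_n)\int_Y g\,d\nu\right|\le C\rho(m)\|g\|_{L^1(\nu)}$$ for all $n,m\in\mathbb{N}$ and all $g\in L^1(\nu)$ supported on $\bigcup_{n\in\mathbb{N}}E_n$. *)

theory Defs
  imports "HOL-Probability.Probability"
begin

definition measure_preserving_system :: "'a measure \<Rightarrow> ('a \<Rightarrow> 'a) \<Rightarrow> bool" where
  "measure_preserving_system M T \<longleftrightarrow>
     prob_space M \<and> T \<in> measurable M M \<and>
     (\<forall>A\<in>sets M. emeasure M (T -` A \<inter> space M) = emeasure M A)"

definition invariant_sets :: "'a measure \<Rightarrow> ('a \<Rightarrow> 'a) \<Rightarrow> 'a set set" where
  "invariant_sets M T = {A \<in> sets M. AE x in M. T x \<in> A \<longleftrightarrow> x \<in> A}"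

text \<open>Only the underlying \<sigma>-algebra of the following measure space is relevant: it is
  the second argument of \<^const>\<open>real_cond_exp\<close>.\<close>

definition invariant_algebra :: "'a measure \<Rightarrow> ('a \<Rightarrow> 'a) \<Rightarrow> 'a measure" where
  "invariant_algebra M T = sigma (space M) (invariant_sets M T)"

lemma space_invariant_algebra: "space (invariant_algebra M T) = space M"
  by (simp add: invariant_algebra_def space_measure_of_conv)

lemma sets_invariant_algebra:
  assumes "measure_preserving_system M T"
  shows "sets (invariant_algebra M T) = invariant_sets M T"
proof -
  have T: "T x \<in> space M" if "x \<in> space M" for x
    using assms that by (auto simp: measure_preserving_system_def measurable_space)
  have "sigma_algebra (space M) (invariant_sets M T)"
    unfolding sigma_algebra_iff2
  proof (intro conjI allI impI ballI)
    show "invariant_sets M T \<subseteq> Pow (space M)"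
      using sets.space_closed by (auto simp: invariant_sets_def)
    show "{} \<in> invariant_sets M T" by (simp add: invariant_sets_def)
  next
    fix A assume "A \<in> invariant_sets M T"
    then have A: "A \<in> sets M" "AE x in M. T x \<in> A \<longleftrightarrow> x \<in> A"
      by (auto simp: invariant_sets_def)
    have "AE x in M. T x \<in> space M - A \<longleftrightarrow> x \<in> space M - A"
      using A(2) AE_space by eventually_elim (auto simp: T)
    with A(1) show "space M - A \<in> invariant_sets M T"
      by (auto simp: invariant_sets_def)
  next
    fix A :: "nat \<Rightarrow> _" assume "range A \<subseteq> invariant_sets M T"
    then have A: "\<And>i. A i \<in> sets M" "\<And>i. AE x in M. T x \<in> A i \<longleftrightarrow> x \<in> A i"
      by (auto simp: invariant_sets_def)
    have "AE x in M. \<forall>i. T x \<in> A i \<longleftrightarrow> x \<in> A i"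
      using A(2) by (simp add: AE_all_countable)
    then have "AE x in M. T x \<in> (\<Union>i. A i) \<longleftrightarrow> x \<in> (\<Union>i. A i)"
      by eventually_elim auto
    with A(1) show "(\<Union>i. A i) \<in> invariant_sets M T"
      by (auto simp: invariant_sets_def)
  qed
  then show ?thesis
    by (simp add: invariant_algebra_def sigma_algebra.sets_measure_of_eq)
qed

lemma subalgebra_invariant_algebra:
  "measure_preserving_system M T \<Longrightarrow> subalgebra M (invariant_algebra M T)"
  by (auto simp: subalgebra_def space_invariant_algebra sets_invariant_algebra invariant_sets_def)

definition Lp_fun :: "'a measure \<Rightarrow> real \<Rightarrow> ('a \<Rightarrow> real) \<Rightarrow> bool" where
  "Lp_fun M p f \<longleftrightarrow> f \<in> borel_measurable M \<and> integrable M (\<lambda>x. \<bar>f x\<bar> powr p)"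

definition ergodic_average ::
  "('a \<Rightarrow> 'a) \<Rightarrow> ('a \<Rightarrow> real) \<Rightarrow> (nat \<Rightarrow> nat) \<Rightarrow> nat \<Rightarrow> 'a \<Rightarrow> real" where
  "ergodic_average T f s N x = (\<Sum>n=1..N. f ((T ^^ s n) x)) / real N"

text \<open>The next two notions quantify over all systems whose points are of type \<^typ>\<open>'b\<close>.
  Sequences are indexed from \<open>1\<close>; their value at \<open>0\<close> is never used. Their terms are
  nonnegative because \<open>T\<close> need not be invertible.\<close>

definition pointwise_universally_good :: "'b itself \<Rightarrow> real \<Rightarrow> (nat \<Rightarrow> nat) \<Rightarrow> bool" where
  "pointwise_universally_good _ p s \<longleftrightarrow>
     (\<forall>(M :: 'b measure) T f. measure_preserving_system M T \<longrightarrow> Lp_fun M p f \<longrightarrow>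
        (AE x in M. convergent (\<lambda>N. ergodic_average T f s N x)))"

definition ergodic_sequence :: "'b itself \<Rightarrow> (nat \<Rightarrow> nat) \<Rightarrow> bool" where
  "ergodic_sequence _ s \<longleftrightarrow>
     (\<forall>(M :: 'b measure) T f. measure_preserving_system M T \<longrightarrow> Lp_fun M 2 f \<longrightarrow>
        (\<lambda>N. \<integral>\<^sup>+x. ennreal ((ergodic_average T f s N x
                 - real_cond_exp M (invariant_algebra M T) f x)\<^sup>2) \<partial>M) \<longlonglongrightarrow> 0)"

definition hitting_times :: "('a \<Rightarrow> 'a) \<Rightarrow> (nat \<Rightarrow> 'a set) \<Rightarrow> 'a \<Rightarrow> nat set" where
  "hitting_times S E y = {k. 1 \<le> k \<and> (S ^^ k) y \<in> E k}"

text \<open>The auxiliary value at \<open>0\<close> makes the recursion uniform. The infimum is over a nonempty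
  set at every step precisely when \<^term>\<open>hitting_times S E y\<close> is infinite.\<close>

primrec return_time :: "('a \<Rightarrow> 'a) \<Rightarrow> (nat \<Rightarrow> 'a set) \<Rightarrow> 'a \<Rightarrow> nat \<Rightarrow> nat" where
  "return_time S E y 0 = 0"
| "return_time S E y (Suc n) = Inf {k. return_time S E y n < k \<and> (S ^^ k) y \<in> E k}"

definition decay_of_correlation ::
  "'a measure \<Rightarrow> ('a \<Rightarrow> 'a) \<Rightarrow> (nat \<Rightarrow> 'a set) \<Rightarrow> (nat \<Rightarrow> real) \<Rightarrow> bool" where
  "decay_of_correlation M S E \<rho> \<longleftrightarrow>
     (\<exists>C>0. \<forall>n\<ge>1. \<forall>m\<ge>1. \<forall>g :: 'a \<Rightarrow> real.
        integrable M g \<longrightarrow> (AE y in M. y \<notin> (\<Union>k\<in>{1..}. E k) \<longrightarrow> g y = 0) \<longrightarrow>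
        \<bar>(LINT y:E n|M. g ((S ^^ m) y)) - measure M (E n) * (LINT y|M. g y)\<bar>
          \<le> C * \<rho> m * (LINT y|M. \<bar>g y\<bar>))"

end

theory Submission
  imports Defs
begin

text \<open>Let \<open>X\<^sub>n(y)\<close> indicate \<open>S\<^sup>n y \<in> E\<^sub>n\<close>, let \<open>\<sigma>\<^sub>n = \<nu>(E\<^sub>n)\<close>, \<open>Z\<^sub>n = X\<^sub>n - \<sigma>\<^sub>n\<close> and
  \<open>W\<^sub>N = \<sigma>\<^sub>1 + \<dots> + \<sigma>\<^sub>N\<close>. Expanding the square bounds the squared \<open>L\<^sup>2\<close> norm of
  \<open>\<Sum>\<^sub>n Z\<^sub>n(y) f(T\<^sup>n x)\<close> in every system by \<open>D\<^sub>N(y) \<parallel>f\<parallel>\<^sup>2\<close>, where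
  \<open>D\<^sub>N = \<Sum>\<^sub>n Z\<^sub>n\<^sup>2 + 2 \<Sum>\<^sub>m \<bar>\<Sum>\<^sub>n Z\<^sub>n Z\<^sub>n\<^sub>+\<^sub>m\<bar>\<close> depends on \<open>y\<close> only. Decay of correlation
  applied to four-fold products gives \<open>\<integral> D\<^sub>N d\<nu> / W\<^sub>N\<^sup>2 = O(N\<^sup>1\<^sup>/\<^sup>2 / W\<^sub>N)\<close>, a negative power of
  \<open>N\<close> because \<open>a < 1/2\<close>, so it is summable along \<open>N = k\<^sup>p\<close> for large \<open>p\<close>. Hence for almost
  every \<open>y\<close> the averages weighted by \<open>X\<^sub>n\<close> and by \<open>\<sigma>\<^sub>n\<close> have the same limits along \<open>k\<^sup>p\<close>; the
  latter converge by Birkhoff's theorem and Abel summation. As \<open>W\<close> grows by a factor tending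
  to \<open>1\<close> between consecutive \<open>k\<^sup>p\<close>, positivity extends the convergence to all \<open>N\<close>. The case
  \<open>f = 1\<close> shows that the number of return times up to \<open>N\<close> is asymptotic to \<open>W\<^sub>N\<close>.\<close>

subsection \<open>Birkhoff's theorem\<close>

lemma measure_preserving_distr:
  assumes "measure_preserving_system M T"
  shows "T \<in> measurable M M" "distr M M T = M"
proof -
  show T: "T \<in> measurable M M"
    using assms by (simp add: measure_preserving_system_def)
  show "distr M M T = M"
    by (rule measure_eqI) (use assms T in \<open>auto simp: measure_preserving_system_def emeasure_distr\<close>)
qed

section \<open>Invariance of integrals under iterates, and invariant functions\<close>

locale mp_system =
  fixes M :: "'a measure" and T :: "'a \<Rightarrow> 'a"
  assumes system: "measure_preserving_system M T"

sublocale mp_system \<subseteq> prob_space M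
  using system by (simp add: measure_preserving_system_def)

sublocale mp_system \<subseteq> finite_measure_subalgebra M "invariant_algebra M T"
  by unfold_locales (simp add: subalgebra_invariant_algebra[OF system])

context mp_system
begin

abbreviation cexp :: "('a \<Rightarrow> real) \<Rightarrow> 'a \<Rightarrow> real" where
  "cexp \<equiv> real_cond_exp M (invariant_algebra M T)"

lemma T_measurable [measurable]: "T \<in> measurable M M"
  using measure_preserving_distr[OF system] by simp

lemma T_space: "x \<in> space M \<Longrightarrow> T x \<in> space M"
  using measurable_space[OF T_measurable] .

lemma distr_funpow: "distr M M (T ^^ n) = M"
proof (induction n)
  case 0
  show ?case by (simp add: distr_id2 id_def)
next
  case (Suc n)
  have "distr M M (T \<circ> (T ^^ n)) = distr (distr M M (T ^^ n)) M T"
    by (rule distr_distr[symmetric]) measurable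
  also have "\<dots> = M"
    using Suc measure_preserving_distr[OF system] by simp
  finally show ?case by (simp add: o_def)
qed

lemma AE_funpow:
  assumes "AE x in M. P x"
  shows "AE x in M. P ((T ^^ n) x)"
proof (rule AE_distrD[where f = "T ^^ n" and M' = M])
  show "T ^^ n \<in> measurable M M" by measurable
  show "AE x in distr M M (T ^^ n). P x"
    using assms by (simp only: distr_funpow)
qed

lemma integral_funpow:
  fixes g :: "'a \<Rightarrow> real"
  assumes [measurable]: "g \<in> borel_measurable M"
  shows "(\<integral>x. g ((T ^^ n) x) \<partial>M) = (\<integral>x. g x \<partial>M)"
proof -
  have "(\<integral>x. g x \<partial>distr M M (T ^^ n)) = (\<integral>x. g ((T ^^ n) x) \<partial>M)"
    by (rule integral_distr) measurable
  then show ?thesis by (simp add: distr_funpow)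
qed

lemma nn_integral_funpow:
  assumes [measurable]: "g \<in> borel_measurable M"
  shows "(\<integral>\<^sup>+x. g ((T ^^ n) x) \<partial>M) = (\<integral>\<^sup>+x. g x \<partial>M)"
proof -
  have "(\<integral>\<^sup>+x. g x \<partial>distr M M (T ^^ n)) = (\<integral>\<^sup>+x. g ((T ^^ n) x) \<partial>M)"
    by (rule nn_integral_distr) measurable
  then show ?thesis by (simp add: distr_funpow)
qed

lemma integrable_funpow:
  fixes g :: "'a \<Rightarrow> real"
  assumes "integrable M g"
  shows "integrable M (\<lambda>x. g ((T ^^ n) x))"
proof (rule integrable_distr[where T = "T ^^ n" and M' = M])
  show "T ^^ n \<in> measurable M M" by measurable
  show "integrable (distr M M (T ^^ n)) g"
    using assms by (simp add: distr_funpow)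
qed

text \<open>Superlevel sets of \<open>h\<close> belong to the invariant algebra, so each is
  preserved by \<open>T\<close> up to a null set. Rational levels need only countably many null
  sets, and they separate any two distinct reals.\<close>

lemma AE_invariant_comp:
  assumes h: "h \<in> borel_measurable (invariant_algebra M T)"
  shows "AE x in M. h (T x) = (h x :: real)"
proof -
  have "AE x in M. \<forall>q\<in>\<rat>. q < h (T x) \<longleftrightarrow> q < h x"
  proof (subst AE_ball_countable[OF countable_rat], rule ballI)
    fix q :: real
    have "{x \<in> space (invariant_algebra M T). q < h x} \<in> sets (invariant_algebra M T)"
      using h by measurable
    then have "{x \<in> space M. q < h x} \<in> invariant_sets M T"
      by (simp add: sets_invariant_algebra[OF system] space_invariant_algebra)
    then have "AE x in M. T x \<in> {x \<in> space M. q < h x} \<longleftrightarrow> x \<in> {x \<in> space M. q < h x}"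
      by (simp add: invariant_sets_def)
    then show "AE x in M. q < h (T x) \<longleftrightarrow> q < h x"
      using AE_space by eventually_elim (auto simp: T_space)
  qed
  then show ?thesis
  proof eventually_elim
    fix x assume *: "\<forall>q\<in>\<rat>. q < h (T x) \<longleftrightarrow> q < h x"
    show "h (T x) = h x"
    proof (rule ccontr)
      assume "h (T x) \<noteq> h x"
      then consider "h (T x) < h x" | "h x < h (T x)" by linarith
      then show False
      proof cases
        case 1
        with Rats_dense_in_real obtain q where "q \<in> \<rat>" "h (T x) < q" "q < h x" by blast
        with * show False by auto
      next
        case 2
        with Rats_dense_in_real obtain q where "q \<in> \<rat>" "h x < q" "q < h (T x)" by blast
        with * show False by auto
      qed
    qed
  qed
qed

lemma AE_invariant_funpow:
  assumes h: "h \<in> borel_measurable (invariant_algebra M T)"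
  shows "AE x in M. \<forall>n. h ((T ^^ n) x) = (h x :: real)"
proof -
  have "AE x in M. \<forall>n. h (T ((T ^^ n) x)) = h ((T ^^ n) x)"
    unfolding AE_all_countable using AE_funpow[OF AE_invariant_comp[OF h]] by blast
  then show ?thesis
  proof eventually_elim
    fix x assume *: "\<forall>n. h (T ((T ^^ n) x)) = h ((T ^^ n) x)"
    show "\<forall>n. h ((T ^^ n) x) = h x"
    proof
      fix n show "h ((T ^^ n) x) = h x"
        using * by (induction n) auto
    qed
  qed
qed

end

text \<open>The maximum of the Birkhoff sums of lengths \<open>0\<close> to \<open>n\<close>.\<close>

primrec birkhoff_max :: "('a \<Rightarrow> 'a) \<Rightarrow> ('a \<Rightarrow> real) \<Rightarrow> nat \<Rightarrow> 'a \<Rightarrow> real" where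
  "birkhoff_max T g 0 x = 0"
| "birkhoff_max T g (Suc n) x = max 0 (g x + birkhoff_max T g n (T x))"

lemma birkhoff_max_nonneg: "0 \<le> birkhoff_max T g n x"
  by (cases n) auto

lemma birkhoff_max_Suc: "birkhoff_max T g n x \<le> birkhoff_max T g (Suc n) x"
proof (induction n arbitrary: x)
  case (Suc n)
  have "birkhoff_max T g (Suc n) x = max 0 (g x + birkhoff_max T g n (T x))" by simp
  also have "\<dots> \<le> max 0 (g x + birkhoff_max T g (Suc n) (T x))"
    using Suc[of "T x"] by linarith
  finally show ?case by simp
qed simp

lemma birkhoff_max_mono: "m \<le> n \<Longrightarrow> birkhoff_max T g m x \<le> birkhoff_max T g n x"
  by (rule lift_Suc_mono_le[where f = "\<lambda>n. birkhoff_max T g n x"]) (rule birkhoff_max_Suc)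

lemma birkhoff_sum_le_max: "(\<Sum>i<n. g ((T ^^ i) x)) \<le> birkhoff_max T g n x"
proof (induction n arbitrary: x)
  case (Suc n)
  have "(\<Sum>i<Suc n. g ((T ^^ i) x)) = g x + (\<Sum>i<n. g ((T ^^ i) (T x)))"
    unfolding sum.lessThan_Suc_shift by (simp add: funpow_swap1)
  with Suc[of "T x"] show ?case by simp
qed simp

section \<open>The maximal ergodic inequality\<close>

context mp_system
begin

lemma integrable_birkhoff_max:
  assumes "integrable M g"
  shows "integrable M (birkhoff_max T g n)"
proof (induction n)
  case (Suc n)
  have "integrable M (\<lambda>x. birkhoff_max T g n (T x))"
    using integrable_funpow[OF Suc, of 1] by simp
  with assms show ?case by simp
qed simp

text \<open>The set where the supremum of the Birkhoff sums is infinite. Unlike the set where this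
  supremum is positive, it is strictly invariant, so it can be tested against the conditional
  expectation. Natural thresholds \<open>K\<close> keep its description countable.\<close>

definition unbounded_sums :: "('a \<Rightarrow> real) \<Rightarrow> 'a set" where
  "unbounded_sums g = {x \<in> space M. \<forall>K::nat. \<exists>n. real K < birkhoff_max T g n x}"

lemma unbounded_sums_sets:
  assumes "integrable M g"
  shows "unbounded_sums g \<in> sets M"
proof -
  have [measurable]: "birkhoff_max T g n \<in> borel_measurable M" for n
    using integrable_birkhoff_max[OF assms] by simp
  show ?thesis unfolding unbounded_sums_def by measurable
qed

text \<open>By the recursion, replacing \<open>x\<close> by \<open>T x\<close> changes the maxima
  essentially by the single finite number \<open>g x\<close>, which cannot affect
  unboundedness.\<close>

lemma unbounded_sums_T:
  assumes "x \<in> space M"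
  shows "T x \<in> unbounded_sums g \<longleftrightarrow> x \<in> unbounded_sums g"
proof
  assume A: "T x \<in> unbounded_sums g"
  have "\<exists>n. real K < birkhoff_max T g n x" for K :: nat
  proof -
    obtain L :: nat where L: "real K - g x < L" using reals_Archimedean2 by blast
    obtain n where "real L < birkhoff_max T g n (T x)"
      using A by (auto simp: unbounded_sums_def)
    with L have "real K < birkhoff_max T g (Suc n) x" by simp
    then show ?thesis ..
  qed
  with assms show "x \<in> unbounded_sums g" by (simp add: unbounded_sums_def)
next
  assume A: "x \<in> unbounded_sums g"
  have "\<exists>n. real K < birkhoff_max T g n (T x)" for K :: nat
  proof -
    obtain L :: nat where L: "real K + g x < L" using reals_Archimedean2 by blast
    obtain n where n: "real L < birkhoff_max T g n x"
      using A by (auto simp: unbounded_sums_def)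
    also have "\<dots> \<le> birkhoff_max T g (Suc n) x" by (rule birkhoff_max_Suc)
    \<comment> \<open>As \<open>L\<close> is a natural number, the maximum at \<open>Suc n\<close>
      is positive, so it equals \<open>g x + birkhoff_max T g n (T x)\<close>.\<close>
    finally have "real K < birkhoff_max T g n (T x)" using L by (auto simp: max_def split: if_splits)
    then show ?thesis ..
  qed
  with assms show "T x \<in> unbounded_sums g" by (simp add: unbounded_sums_def T_space)
qed

text \<open>With \<open>P n\<close> the maxima and \<open>A\<close> the invariant set, the integral
  of \<open>P n (T x)\<close> over \<open>A\<close> equals that of \<open>P n\<close>, which is at
  most that of \<open>P (Suc n)\<close>. So the differences \<open>P (Suc n) x - P n (T x)\<close>
  have nonnegative integral over \<open>A\<close>. On \<open>A\<close> they are eventually equal to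
  \<open>g x\<close>, because \<open>P n (T x)\<close> tends to infinity there.\<close>

lemma maximal_ergodic_inequality:
  assumes g: "integrable M g"
  shows "0 \<le> (\<integral>x. indicator (unbounded_sums g) x * g x \<partial>M)"
proof -
  define A where "A = unbounded_sums g"
  note [measurable] = unbounded_sums_sets[OF g, folded A_def] borel_measurable_integrable[OF g]
  define P where "P = birkhoff_max T g"
  have intP: "integrable M (P n)" for n
    unfolding P_def by (rule integrable_birkhoff_max[OF g])
  then have [measurable]: "P n \<in> borel_measurable M" for n by simp
  have intA: "integrable M (\<lambda>x. indicator A x * h x)" if "integrable M h" for h :: "'a \<Rightarrow> real"
    using integrable_mult_indicator[of A M h] that by simp
  \<comment> \<open>On \<open>A\<close> this is \<open>P (Suc n) x - P n (T x)\<close>: subtract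
    \<open>P n (T x)\<close> inside the maximum of the recursion.\<close>
  define d where "d n x = indicator A x * max (- P n (T x)) (g x)" for n x
  have "0 \<le> (\<integral>x. d n x \<partial>M)" for n
  proof -
    have iT: "integrable M (\<lambda>x. P n (T x))" using integrable_funpow[OF intP, of n 1] by simp
    have "(\<integral>x. indicator A x * P n x \<partial>M) = (\<integral>x. indicator A (T x) * P n (T x) \<partial>M)"
      using integral_funpow[of "\<lambda>x. indicator A x * P n x" 1] by simp
    also have "\<dots> = (\<integral>x. indicator A x * P n (T x) \<partial>M)"
      by (rule Bochner_Integration.integral_cong) (auto simp: A_def unbounded_sums_T indicator_def)
    finally have eq: "(\<integral>x. indicator A x * P n x \<partial>M) = (\<integral>x. indicator A x * P n (T x) \<partial>M)" .
    have "(\<integral>x. indicator A x * P n x \<partial>M) \<le> (\<integral>x. indicator A x * P (Suc n) x \<partial>M)"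
      by (rule integral_mono[OF intA[OF intP] intA[OF intP]])
        (auto simp: P_def intro!: mult_left_mono birkhoff_max_mono simp del: birkhoff_max.simps)
    also have "\<dots> = (\<integral>x. indicator A x * P n (T x) + d n x \<partial>M)"
      by (rule Bochner_Integration.integral_cong) (auto simp: d_def P_def indicator_def)
    also have "\<dots> = (\<integral>x. indicator A x * P n (T x) \<partial>M) + (\<integral>x. d n x \<partial>M)"
      unfolding d_def by (intro Bochner_Integration.integral_add intA iT g integrable_max) (simp add: iT)
    finally show ?thesis using eq by simp
  qed
  moreover have "(\<lambda>n. \<integral>x. d n x \<partial>M) \<longlonglongrightarrow> (\<integral>x. indicator A x * g x \<partial>M)"
  proof (rule integral_dominated_convergence[where w = "\<lambda>x. \<bar>g x\<bar>"])
    show "AE x in M. (\<lambda>n. d n x) \<longlonglongrightarrow> indicator A x * g x"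
    proof (rule AE_I2)
      fix x assume x: "x \<in> space M"
      show "(\<lambda>n. d n x) \<longlonglongrightarrow> indicator A x * g x"
      proof (cases "x \<in> A")
        case True
        then have "T x \<in> unbounded_sums g" using unbounded_sums_T[OF x] by (simp add: A_def)
        then obtain N where N: "real (nat \<lceil>- g x\<rceil>) < P N (T x)"
          by (auto simp: unbounded_sums_def P_def)
        have "eventually (\<lambda>n. d n x = indicator A x * g x) sequentially"
          using eventually_ge_at_top[of N]
        proof eventually_elim
          case (elim n)
          have "P N (T x) \<le> P n (T x)" unfolding P_def by (rule birkhoff_max_mono[OF elim])
          with N have "- P n (T x) \<le> g x" by linarith
          then show ?case by (simp add: d_def max_def)
        qed
        then show ?thesis by (rule tendsto_eventually)
      qed (simp add: d_def)
    qed
    \<comment> \<open>Since \<open>- P n (T x)\<close> is at most 0, the maximum lies between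
      \<open>g x\<close> and 0 when \<open>g x\<close> is negative and equals \<open>g x\<close>
      otherwise.\<close>
    show "AE x in M. norm (d n x) \<le> \<bar>g x\<bar>" for n
    proof (rule AE_I2)
      fix x
      have "0 \<le> P n (T x)" unfolding P_def by (rule birkhoff_max_nonneg)
      then show "norm (d n x) \<le> \<bar>g x\<bar>" by (auto simp: d_def indicator_def)
    qed
  qed (use g in \<open>auto simp: d_def\<close>)
  ultimately show ?thesis
    unfolding A_def by (intro LIMSEQ_le_const) auto
qed

section \<open>From the maximal inequality to pointwise bounds on Birkhoff sums\<close>

text \<open>On the invariant set \<open>A\<close> where the sums of
  \<open>g = f - cexp f - \<epsilon>\<close> are unbounded, \<open>f\<close> and
  \<open>cexp f\<close> have equal integrals, so \<open>g\<close> integrates to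
  \<open>- prob A * \<epsilon>\<close>. The maximal inequality forces \<open>prob A = 0\<close>. Off
  \<open>A\<close> the sums of \<open>g\<close> are bounded by some \<open>K\<close>, and
  \<open>cexp f\<close> is constant along almost every orbit.\<close>

lemma birkhoff_upper:
  assumes f: "integrable M f" and "0 < \<epsilon>"
  shows "AE x in M. \<exists>K. \<forall>n. (\<Sum>i<n. f ((T ^^ i) x)) \<le> real n * (cexp f x + \<epsilon>) + K"
proof -
  define g where "g x = f x - cexp f x - \<epsilon>" for x
  have icf: "integrable M (cexp f)" using real_cond_exp_int(1)[OF f] .
  have g: "integrable M g" unfolding g_def using f icf by auto
  define A where "A = unbounded_sums g"
  have A[measurable]: "A \<in> sets M" using unbounded_sums_sets[OF g] by (simp add: A_def)
  have "A \<in> sets (invariant_algebra M T)"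
    unfolding sets_invariant_algebra[OF system] invariant_sets_def
    using A by (auto simp: A_def unbounded_sums_T)
  then have eq: "(\<integral>x\<in>A. f x \<partial>M) = (\<integral>x\<in>A. cexp f x \<partial>M)" by (rule real_cond_exp_intA[OF f])
  have intA: "integrable M (\<lambda>x. indicator A x * h x)" if "integrable M h" for h :: "'a \<Rightarrow> real"
    using integrable_mult_indicator[OF A that] by simp
  have "(\<integral>x. indicator A x * g x \<partial>M)
      = (\<integral>x. indicator A x * f x - indicator A x * cexp f x - indicator A x * \<epsilon> \<partial>M)"
    by (rule Bochner_Integration.integral_cong) (auto simp: g_def algebra_simps)
  also have "\<dots> = (\<integral>x. indicator A x * f x \<partial>M) - (\<integral>x. indicator A x * cexp f x \<partial>M)
      - (\<integral>x. indicator A x * \<epsilon> \<partial>M)"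
    using intA[OF f] intA[OF icf] intA[of "\<lambda>_. \<epsilon>"] by simp
  also have "\<dots> = - (prob A * \<epsilon>)"
    using eq by (simp add: set_lebesgue_integral_def)
  finally have "0 \<le> - (prob A * \<epsilon>)"
    using maximal_ergodic_inequality[OF g] by (simp add: A_def)
  with \<open>0 < \<epsilon>\<close> have "prob A = 0"
    using measure_nonneg[of M A] by (simp add: mult_le_0_iff)
  then have "A \<in> null_sets M" by (simp add: null_sets_def emeasure_eq_measure)
  then have "AE x in M. x \<notin> A" by (rule AE_not_in)
  moreover have "AE x in M. \<forall>n. cexp f ((T ^^ n) x) = cexp f x"
    by (rule AE_invariant_funpow) (rule borel_measurable_cond_exp)
  ultimately show ?thesis
    using AE_space
  proof eventually_elim
    case (elim x)
    then obtain K :: nat where K: "\<And>n. birkhoff_max T g n x \<le> real K"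
      by (auto simp: A_def unbounded_sums_def not_less)
    have "(\<Sum>i<n. f ((T ^^ i) x)) \<le> real n * (cexp f x + \<epsilon>) + real K" for n
    proof -
      have "(\<Sum>i<n. f ((T ^^ i) x)) - real n * (cexp f x + \<epsilon>) = (\<Sum>i<n. g ((T ^^ i) x))"
        using elim by (simp add: g_def sum_subtractf algebra_simps)
      also have "\<dots> \<le> real K" using birkhoff_sum_le_max K by (rule order_trans)
      finally show ?thesis by simp
    qed
    then show ?case by blast
  qed
qed

text \<open>Apply the upper bound to \<open>f\<close> and \<open>- f\<close> with
  \<open>\<epsilon> = inverse (Suc j)\<close>, so that one null set serves all
  \<open>\<epsilon>\<close>. The bounds are taken at \<open>T x\<close> because these sums start at
  index 1. The error form \<open>\<epsilon> * real n + K\<close> is the one that summation by parts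
  can use.\<close>

lemma birkhoff_bound:
  assumes f: "integrable M f"
  shows "AE x in M. \<forall>\<epsilon>>0. \<exists>K. \<forall>n.
    \<bar>(\<Sum>i=1..n. f ((T ^^ i) x)) - real n * cexp f x\<bar> \<le> \<epsilon> * real n + K"
proof -
  have mf: "integrable M (\<lambda>x. - f x)" using f by simp
  have "AE x in M. cexp (\<lambda>x. - f x) x = - cexp f x"
    using real_cond_exp_cmult[OF f, of "-1"] by simp
  then have neg: "AE x in M. cexp (\<lambda>x. - f x) (T x) = - cexp f (T x)"
    using AE_funpow[of _ 1] by simp
  have "AE x in M. \<forall>j::nat.
     (\<exists>K. \<forall>n. (\<Sum>i<n. f ((T ^^ i) (T x))) \<le> real n * (cexp f (T x) + inverse (Suc j)) + K) \<and>
     (\<exists>K. \<forall>n. (\<Sum>i<n. - f ((T ^^ i) (T x))) \<le> real n * (cexp (\<lambda>x. - f x) (T x) + inverse (Suc j)) + K)"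
    unfolding AE_all_countable
  proof (intro allI AE_conjI)
    fix j :: nat
    have e: "0 < inverse (real (Suc j))" by simp
    show "AE x in M. \<exists>K. \<forall>n. (\<Sum>i<n. f ((T ^^ i) (T x))) \<le> real n * (cexp f (T x) + inverse (Suc j)) + K"
      using AE_funpow[OF birkhoff_upper[OF f e], of 1] by simp
    show "AE x in M. \<exists>K. \<forall>n. (\<Sum>i<n. - f ((T ^^ i) (T x))) \<le> real n * (cexp (\<lambda>x. - f x) (T x) + inverse (Suc j)) + K"
      using AE_funpow[OF birkhoff_upper[OF mf e], of 1] by simp
  qed
  then show ?thesis
    using neg AE_invariant_comp[OF borel_measurable_cond_exp[of M "invariant_algebra M T" f]]
  proof eventually_elim
    case (elim x)
    show ?case
    proof (intro allI impI)
      fix \<epsilon> :: real assume "0 < \<epsilon>"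
      then obtain j where j: "inverse (real (Suc j)) < \<epsilon>" using reals_Archimedean by blast
      obtain K where K: "\<And>n. (\<Sum>i<n. f ((T ^^ i) (T x))) \<le> real n * (cexp f x + inverse (Suc j)) + K"
        using elim by metis
      obtain L where L: "\<And>n. (\<Sum>i<n. - f ((T ^^ i) (T x))) \<le> real n * (- cexp f x + inverse (Suc j)) + L"
        using elim by metis
      have "\<bar>(\<Sum>i=1..n. f ((T ^^ i) x)) - real n * cexp f x\<bar> \<le> \<epsilon> * real n + max K L" for n
      proof -
        have "(\<Sum>i=1..n. f ((T ^^ i) x)) = (\<Sum>i<n. f ((T ^^ i) (T x)))"
          by (rule sum.reindex_bij_witness[of _ Suc "\<lambda>i. i - 1"])
             (auto simp: gr0_conv_Suc funpow_swap1 Suc_le_eq)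
        moreover have "real n * inverse (Suc j) \<le> \<epsilon> * real n"
          using mult_right_mono[OF less_imp_le[OF j], of "real n"] by (simp add: mult.commute)
        ultimately show ?thesis
          using K[of n] L[of n] by (auto simp: sum_negf algebra_simps)
      qed
      then show "\<exists>K. \<forall>n. \<bar>(\<Sum>i=1..n. f ((T ^^ i) x)) - real n * cexp f x\<bar> \<le> \<epsilon> * real n + K"
        by blast
    qed
  qed
qed

end

subsection \<open>Weighted ergodic averages\<close>

text \<open>Summation by parts: the weights decrease, so their differences are nonnegative and the
  bounds on the partial sums of \<open>b\<close> can be inserted term by term.\<close>

lemma abel_summation_bound:
  fixes \<sigma> b :: "nat \<Rightarrow> real"
  assumes dec: "\<And>m n. 1 \<le> m \<Longrightarrow> m \<le> n \<Longrightarrow> \<sigma> n \<le> \<sigma> m"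
    and nonneg: "\<And>n. 1 \<le> n \<Longrightarrow> 0 \<le> \<sigma> n"
    and B: "\<And>n. \<bar>\<Sum>i=1..n. b i\<bar> \<le> \<epsilon> * real n + K"
    and "1 \<le> N"
  shows "\<bar>\<Sum>i=1..N. \<sigma> i * b i\<bar> \<le> \<epsilon> * (\<Sum>i=1..N. \<sigma> i) + K * \<sigma> 1"
proof -
  define B where "B n = (\<Sum>i=1..n. b i)" for n
  \<comment> \<open>The right side is the sum of
    \<open>(\<sigma> n - \<sigma> (Suc n)) * (\<epsilon> * real n + K)\<close> over
    \<open>1 \<le> n < N\<close> in closed form.\<close>
  have "\<bar>(\<Sum>i=1..N. \<sigma> i * b i) - \<sigma> N * B N\<bar>
      \<le> \<epsilon> * ((\<Sum>i=1..N. \<sigma> i) - real N * \<sigma> N) + K * (\<sigma> 1 - \<sigma> N)"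
    using \<open>1 \<le> N\<close>
  proof (induction N rule: dec_induct)
    case base
    show ?case by (simp add: B_def)
  next
    case (step n)
    have d: "0 \<le> \<sigma> n - \<sigma> (Suc n)" using dec[of n "Suc n"] step by simp
    have "(\<Sum>i=1..Suc n. \<sigma> i * b i) - \<sigma> (Suc n) * B (Suc n)
        = ((\<Sum>i=1..n. \<sigma> i * b i) - \<sigma> n * B n) + (\<sigma> n - \<sigma> (Suc n)) * B n"
      by (simp add: B_def algebra_simps)
    moreover have "\<bar>(\<sigma> n - \<sigma> (Suc n)) * B n\<bar> = (\<sigma> n - \<sigma> (Suc n)) * \<bar>B n\<bar>"
      using d by (simp add: abs_mult)
    ultimately have "\<bar>(\<Sum>i=1..Suc n. \<sigma> i * b i) - \<sigma> (Suc n) * B (Suc n)\<bar>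
        \<le> \<bar>(\<Sum>i=1..n. \<sigma> i * b i) - \<sigma> n * B n\<bar> + (\<sigma> n - \<sigma> (Suc n)) * \<bar>B n\<bar>"
      by linarith
    also have "\<dots> \<le> (\<epsilon> * ((\<Sum>i=1..n. \<sigma> i) - real n * \<sigma> n) + K * (\<sigma> 1 - \<sigma> n))
        + (\<sigma> n - \<sigma> (Suc n)) * (\<epsilon> * real n + K)"
      using step.IH B[of n] d unfolding B_def by (intro add_mono mult_left_mono) auto
    also have "\<dots> = \<epsilon> * ((\<Sum>i=1..Suc n. \<sigma> i) - real (Suc n) * \<sigma> (Suc n)) + K * (\<sigma> 1 - \<sigma> (Suc n))"
      by (simp add: algebra_simps)
    finally show ?case .
  qed
  moreover have "\<bar>\<sigma> N * B N\<bar> \<le> \<sigma> N * (\<epsilon> * real N + K)"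
    using B[of N] nonneg[OF \<open>1 \<le> N\<close>] by (simp add: abs_mult B_def mult_left_mono)
  ultimately have "\<bar>\<Sum>i=1..N. \<sigma> i * b i\<bar> \<le> (\<epsilon> * ((\<Sum>i=1..N. \<sigma> i) - real N * \<sigma> N) + K * (\<sigma> 1 - \<sigma> N))
      + \<sigma> N * (\<epsilon> * real N + K)" by linarith
  then show ?thesis by (simp add: algebra_simps)
qed

section \<open>Weighted sums and their correlations\<close>

text \<open>The off-diagonal products are grouped by the gap \<open>m\<close>. This form is used
  twice: for weighted sums along \<open>T\<close> and for the correlations of the centred hits along
  \<open>S\<close>.\<close>

lemma square_sum_correlations:
  fixes a :: "nat \<Rightarrow> real"
  shows "(\<Sum>n=1..N. a n)\<^sup>2
    = (\<Sum>n=1..N. (a n)\<^sup>2) + 2 * (\<Sum>m=1..N. \<Sum>n=1..N-m. a n * a (n + m))"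
proof (induction N)
  case (Suc N)
  have inner: "(\<Sum>n=1..Suc N - m. a n * a (n + m))
      = (\<Sum>n=1..N-m. a n * a (n + m)) + a (Suc N - m) * a (Suc N)" if "m \<in> {1..N}" for m
    using that by (simp add: Suc_diff_le)
  have "(\<Sum>m=1..N. a (Suc N - m) * a (Suc N)) = (\<Sum>n=1..N. a n * a (Suc N))"
    by (rule sum.reindex_bij_witness[of _ "\<lambda>n. Suc N - n" "\<lambda>n. Suc N - n"]) auto
  moreover have "(\<Sum>m=1..Suc N. \<Sum>n=1..Suc N - m. a n * a (n + m))
      = (\<Sum>m=1..N. \<Sum>n=1..Suc N - m. a n * a (n + m))" by simp
  moreover have "\<dots> = (\<Sum>m=1..N. (\<Sum>n=1..N-m. a n * a (n + m)) + a (Suc N - m) * a (Suc N))"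
    by (rule sum.cong[OF refl inner])
  ultimately have "(\<Sum>m=1..Suc N. \<Sum>n=1..Suc N - m. a n * a (n + m))
      = (\<Sum>m=1..N. \<Sum>n=1..N-m. a n * a (n + m)) + (\<Sum>n=1..N. a n) * a (Suc N)"
    by (simp only: sum.distrib sum_distrib_right)
  with Suc show ?case by (simp add: power2_eq_square algebra_simps)
qed simp

text \<open>The quantity \<open>D\<^sub>N\<close> of the overview for general weights. The absolute
  value stands outside the sum over \<open>n\<close> because the correlation of \<open>f\<close> at
  gap \<open>m\<close> does not depend on \<open>n\<close>; cancellation between the weights within
  one gap is thus retained.\<close>

definition correlation_sum :: "(nat \<Rightarrow> real) \<Rightarrow> nat \<Rightarrow> real" where
  "correlation_sum v N = (\<Sum>n=1..N. (v n)\<^sup>2) + 2 * (\<Sum>m=1..N. \<bar>\<Sum>n=1..N-m. v n * v (n + m)\<bar>)"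

lemma correlation_sum_nonneg: "0 \<le> correlation_sum v N"
  by (auto simp: correlation_sum_def intro!: add_nonneg_nonneg sum_nonneg mult_nonneg_nonneg)

lemma integrable_mult_L2:
  fixes f g :: "'a \<Rightarrow> real"
  assumes [measurable]: "f \<in> borel_measurable M" "g \<in> borel_measurable M"
    and "integrable M (\<lambda>x. (f x)\<^sup>2)" "integrable M (\<lambda>x. (g x)\<^sup>2)"
  shows "integrable M (\<lambda>x. f x * g x)"
proof (rule Bochner_Integration.integrable_bound)
  show "integrable M (\<lambda>x. (f x)\<^sup>2 + (g x)\<^sup>2)" using assms by simp
  show "AE x in M. norm (f x * g x) \<le> norm ((f x)\<^sup>2 + (g x)\<^sup>2)"
  proof (rule AE_I2)
    fix x
    have "0 \<le> (\<bar>f x\<bar> - \<bar>g x\<bar>)\<^sup>2" by simp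
    then have "2 * (\<bar>f x\<bar> * \<bar>g x\<bar>) \<le> (f x)\<^sup>2 + (g x)\<^sup>2" by (simp add: power2_diff)
    moreover have "0 \<le> \<bar>f x\<bar> * \<bar>g x\<bar>" by simp
    ultimately show "norm (f x * g x) \<le> norm ((f x)\<^sup>2 + (g x)\<^sup>2)"
      unfolding abs_mult real_norm_def by linarith
  qed
qed simp

text \<open>Only the invariance of the correlations of \<open>f\<close> enters, so no spectral theorem is needed.\<close>

lemma (in mp_system) weighted_sum_L2:
  fixes f :: "'a \<Rightarrow> real"
  assumes [measurable]: "f \<in> borel_measurable M" and f2: "integrable M (\<lambda>x. (f x)\<^sup>2)"
  shows "integrable M (\<lambda>x. (\<Sum>n=1..N. v n * f ((T ^^ n) x))\<^sup>2)"
    and "(\<integral>x. (\<Sum>n=1..N. v n * f ((T ^^ n) x))\<^sup>2 \<partial>M) \<le> correlation_sum v N * (\<integral>x. (f x)\<^sup>2 \<partial>M)"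
proof -
  have int: "integrable M (\<lambda>x. f ((T ^^ n) x) * f ((T ^^ m) x))" for n m
    by (rule integrable_mult_L2) (use integrable_funpow[OF f2] in auto)
  have eq: "(\<Sum>n=1..N. v n * f ((T ^^ n) x))\<^sup>2 = (\<Sum>n=1..N. (v n)\<^sup>2 * (f ((T ^^ n) x))\<^sup>2)
     + 2 * (\<Sum>m=1..N. \<Sum>n=1..N-m. v n * v (n + m) * (f ((T ^^ n) x) * f ((T ^^ (n + m)) x)))" for x
    by (subst square_sum_correlations) (simp add: power_mult_distrib mult_ac)
  have int2: "integrable M (\<lambda>x. (f ((T ^^ n) x))\<^sup>2)" for n
    using int[of n n] by (simp add: power2_eq_square)
  show "integrable M (\<lambda>x. (\<Sum>n=1..N. v n * f ((T ^^ n) x))\<^sup>2)"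
    unfolding eq using int int2 by simp
  have shift: "(\<integral>x. f ((T ^^ n) x) * f ((T ^^ (n + m)) x) \<partial>M) = (\<integral>x. f x * f ((T ^^ m) x) \<partial>M)" for n m
    using integral_funpow[of "\<lambda>x. f x * f ((T ^^ m) x)" n] by (simp add: funpow_add add.commute[of n m])
  have shift2: "(\<integral>x. (f ((T ^^ n) x))\<^sup>2 \<partial>M) = (\<integral>x. (f x)\<^sup>2 \<partial>M)" for n
    by (rule integral_funpow[of "\<lambda>x. (f x)\<^sup>2"]) simp
  define I where "I = (\<integral>x. (f x)\<^sup>2 \<partial>M)"
  \<comment> \<open>The inequality of arithmetic and geometric means suffices, since
    \<open>f\<close> and its translate have the same second moment.\<close>
  have corr: "\<bar>\<integral>x. f x * f ((T ^^ m) x) \<partial>M\<bar> \<le> I" for m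
  proof -
    have "\<bar>\<integral>x. f x * f ((T ^^ m) x) \<partial>M\<bar> \<le> (\<integral>x. \<bar>f x * f ((T ^^ m) x)\<bar> \<partial>M)"
      using integral_norm_bound[of M "\<lambda>x. f x * f ((T ^^ m) x)"] by simp
    also have "\<dots> \<le> (\<integral>x. ((f x)\<^sup>2 + (f ((T ^^ m) x))\<^sup>2) / 2 \<partial>M)"
    proof (rule integral_mono)
      show "integrable M (\<lambda>x. \<bar>f x * f ((T ^^ m) x)\<bar>)" using int[of 0 m] by simp
      show "integrable M (\<lambda>x. ((f x)\<^sup>2 + (f ((T ^^ m) x))\<^sup>2) / 2)" using f2 int2 by simp
      fix x
      have "0 \<le> (\<bar>f x\<bar> - \<bar>f ((T ^^ m) x)\<bar>)\<^sup>2" by simp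
      then show "\<bar>f x * f ((T ^^ m) x)\<bar> \<le> ((f x)\<^sup>2 + (f ((T ^^ m) x))\<^sup>2) / 2"
        by (simp add: power2_diff abs_mult)
    qed
    also have "\<dots> = I" using f2 int2 shift2 by (simp add: I_def)
    finally show ?thesis .
  qed
  have "(\<integral>x. (\<Sum>n=1..N. v n * f ((T ^^ n) x))\<^sup>2 \<partial>M) = (\<Sum>n=1..N. (v n)\<^sup>2 * I)
     + 2 * (\<Sum>m=1..N. \<Sum>n=1..N-m. v n * v (n + m) * (\<integral>x. f x * f ((T ^^ m) x) \<partial>M))"
    unfolding eq using int int2 by (simp add: shift shift2 I_def)
  also have "\<dots> \<le> (\<Sum>n=1..N. (v n)\<^sup>2 * I) + 2 * (\<Sum>m=1..N. \<bar>\<Sum>n=1..N-m. v n * v (n + m)\<bar> * I)"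
  proof (intro add_left_mono mult_left_mono sum_mono)
    fix m
    have "(\<Sum>n=1..N-m. v n * v (n + m) * (\<integral>x. f x * f ((T ^^ m) x) \<partial>M))
        = (\<Sum>n=1..N-m. v n * v (n + m)) * (\<integral>x. f x * f ((T ^^ m) x) \<partial>M)"
      by (simp add: sum_distrib_right)
    also have "\<dots> \<le> \<bar>\<Sum>n=1..N-m. v n * v (n + m)\<bar> * \<bar>\<integral>x. f x * f ((T ^^ m) x) \<partial>M\<bar>"
      by (simp flip: abs_mult)
    also have "\<dots> \<le> \<bar>\<Sum>n=1..N-m. v n * v (n + m)\<bar> * I"
      by (rule mult_left_mono[OF corr]) simp
    finally show "(\<Sum>n=1..N-m. v n * v (n + m) * (\<integral>x. f x * f ((T ^^ m) x) \<partial>M)) \<le> \<dots>" .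
  qed simp
  also have "\<dots> = correlation_sum v N * I"
    by (simp add: correlation_sum_def sum_distrib_right sum_distrib_left algebra_simps)
  finally show "(\<integral>x. (\<Sum>n=1..N. v n * f ((T ^^ n) x))\<^sup>2 \<partial>M) \<le> correlation_sum v N * (\<integral>x. (f x)\<^sup>2 \<partial>M)"
    by (simp add: I_def)
qed

text \<open>Exchanging sum and integral shows that the sum of the \<open>g k\<close> has finite
  integral, hence is finite almost everywhere. It serves both for the points \<open>x\<close> of a
  system and for the points \<open>y\<close> that define the weights.\<close>

lemma AE_summable_integrals:
  fixes g :: "nat \<Rightarrow> 'a \<Rightarrow> real"
  assumes int: "\<And>k. integrable M (g k)" and nonneg: "\<And>k x. 0 \<le> g k x"
    and le: "\<And>k. (\<integral>x. g k x \<partial>M) \<le> s k" and s: "summable s"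
  shows "AE x in M. summable (\<lambda>k. g k x)"
proof -
  have [measurable]: "g k \<in> borel_measurable M" for k using int by simp
  have s0: "0 \<le> s k" for k
    using le[of k] Bochner_Integration.integral_nonneg[of M "g k"] nonneg by (meson order_trans)
  have "(\<integral>\<^sup>+x. (\<Sum>k. ennreal (g k x)) \<partial>M) = (\<Sum>k. \<integral>\<^sup>+x. ennreal (g k x) \<partial>M)"
    by (rule nn_integral_suminf) simp
  also have "\<dots> \<le> (\<Sum>k. ennreal (s k))"
  proof (intro suminf_le allI)
    show "(\<integral>\<^sup>+x. ennreal (g k x) \<partial>M) \<le> ennreal (s k)" for k
      using le[of k] nonneg by (subst nn_integral_eq_integral[OF int]) (auto intro: ennreal_leI)
  qed auto
  also have "\<dots> < \<infinity>"
    using s s0 by (simp add: suminf_ennreal2 less_top)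
  finally have "AE x in M. (\<Sum>k. ennreal (g k x)) \<noteq> \<infinity>"
    by (intro nn_integral_PInf_AE) auto
  then show ?thesis
    by eventually_elim (use nonneg in \<open>auto intro!: summable_suminf_not_top\<close>)
qed

section \<open>Interpolation between consecutive powers\<close>

text \<open>For \<open>n\<close> between \<open>k ^ p\<close> and \<open>Suc k ^ p\<close>,
  monotonicity of numerator and denominator traps \<open>S n / W n\<close> between quotients that
  differ from those along the powers by a factor tending to 1.\<close>

lemma tendsto_along_powers:
  fixes S W :: "nat \<Rightarrow> real"
  assumes S: "mono S" "\<And>n. 0 \<le> S n" and W: "mono W" "\<And>n. 1 \<le> n \<Longrightarrow> 0 < W n" and "1 \<le> p"
    and lim: "(\<lambda>k. S (k ^ p) / W (k ^ p)) \<longlonglongrightarrow> L"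
    and ratio: "(\<lambda>k. W (Suc k ^ p) / W (k ^ p)) \<longlonglongrightarrow> 1"
  shows "(\<lambda>n. S n / W n) \<longlonglongrightarrow> L"
proof -
  have "\<exists>k\<ge>1. k ^ p \<le> n \<and> n < Suc k ^ p" if "1 \<le> n" for n :: nat
  proof -
    have "Suc n ^ 1 \<le> Suc n ^ p" using \<open>1 \<le> p\<close> by (rule power_increasing) simp
    then have "n < Suc n ^ p" by simp
    moreover have "\<not> n < 0 ^ p" using \<open>1 \<le> p\<close> by (simp add: power_0_left)
    ultimately obtain k where k: "\<forall>i\<le>k. \<not> n < i ^ p" "n < Suc k ^ p"
      using ex_least_nat_less[of "\<lambda>i. n < i ^ p" "Suc n"] by auto
    with that have "k \<noteq> 0" by (cases "k = 0") auto
    with k show ?thesis by (auto simp: not_less Suc_le_eq)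
  qed
  then obtain \<kappa> where \<kappa>: "\<And>n. 1 \<le> n \<Longrightarrow> 1 \<le> \<kappa> n \<and> \<kappa> n ^ p \<le> n \<and> n < Suc (\<kappa> n) ^ p" by metis
  have top: "filterlim \<kappa> sequentially sequentially"
    unfolding filterlim_at_top
  proof
    fix K
    show "eventually (\<lambda>n. K \<le> \<kappa> n) sequentially"
      using eventually_ge_at_top[of "max 1 (K ^ p)"]
    proof eventually_elim
      case (elim n)
      then have "K ^ p < Suc (\<kappa> n) ^ p" using \<kappa>[of n] by simp
      then show ?case by (meson less_Suc_eq_le power_less_imp_less_base zero_le)
    qed
  qed
  \<comment> \<open>\<open>l k\<close> reduces to \<open>S (k ^ p) / W (Suc k ^ p)\<close> and
    \<open>u k\<close> to \<open>S (Suc k ^ p) / W (k ^ p)\<close>; the factored form exposes their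
    limits.\<close>
  define l where "l k = S (k ^ p) / W (k ^ p) / (W (Suc k ^ p) / W (k ^ p))" for k
  define u where "u k = S (Suc k ^ p) / W (Suc k ^ p) * (W (Suc k ^ p) / W (k ^ p))" for k
  have "l \<longlonglongrightarrow> L / 1"
    unfolding l_def by (intro tendsto_divide lim ratio) simp
  then have l: "(\<lambda>n. l (\<kappa> n)) \<longlonglongrightarrow> L" using filterlim_compose[OF _ top] by simp
  have "u \<longlonglongrightarrow> L * 1"
    unfolding u_def by (intro tendsto_mult ratio LIMSEQ_Suc[OF lim])
  then have u: "(\<lambda>n. u (\<kappa> n)) \<longlonglongrightarrow> L" using filterlim_compose[OF _ top] by simp
  show ?thesis
  proof (rule tendsto_sandwich[OF _ _ l u])
    show "eventually (\<lambda>n. l (\<kappa> n) \<le> S n / W n) sequentially"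
      using eventually_ge_at_top[of 1]
    proof eventually_elim
      case (elim n)
      note k = \<kappa>[OF elim]
      have pos: "0 < W (\<kappa> n ^ p)" "0 < W n" "0 < W (Suc (\<kappa> n) ^ p)" using k elim by (auto intro!: W(2))
      have "l (\<kappa> n) = S (\<kappa> n ^ p) / W (Suc (\<kappa> n) ^ p)" using pos by (simp add: l_def)
      also have "\<dots> \<le> S n / W n"
        using k pos S by (intro frac_le monoD[OF S(1)] monoD[OF W(1)]) auto
      finally show ?case .
    qed
    show "eventually (\<lambda>n. S n / W n \<le> u (\<kappa> n)) sequentially"
      using eventually_ge_at_top[of 1]
    proof eventually_elim
      case (elim n)
      note k = \<kappa>[OF elim]
      have pos: "0 < W (\<kappa> n ^ p)" "0 < W n" "0 < W (Suc (\<kappa> n) ^ p)" using k elim by (auto intro!: W(2))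
      have "S n / W n \<le> S (Suc (\<kappa> n) ^ p) / W (\<kappa> n ^ p)"
        using k pos S by (intro frac_le monoD[OF S(1)] monoD[OF W(1)]) auto
      also have "\<dots> = u (\<kappa> n)" using pos by (simp add: u_def)
      finally show ?case .
    qed
  qed
qed

section \<open>Convergence of averages with random weights\<close>

text \<open>Collects what is required of the weights at a single point \<open>y\<close>.
  \<open>X\<close> is compared with its expected size \<open>\<sigma>\<close> only through the last
  assumption, which mentions no system \<open>(M, T)\<close>; so the same weights can be used in all
  systems.\<close>

locale good_weights =
  fixes X \<sigma> :: "nat \<Rightarrow> real" and W :: "nat \<Rightarrow> real" and p :: nat
  assumes X_nonneg: "0 \<le> X n"
    and \<sigma>_pos: "1 \<le> n \<Longrightarrow> 0 < \<sigma> n"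
    and \<sigma>_dec: "1 \<le> m \<Longrightarrow> m \<le> n \<Longrightarrow> \<sigma> n \<le> \<sigma> m"
    and W_def: "W N = (\<Sum>n=1..N. \<sigma> n)"
    and W_top: "filterlim W at_top sequentially"
    and p: "1 \<le> p"
    and summable_correlations: "summable (\<lambda>k. correlation_sum (\<lambda>n. X n - \<sigma> n) (k ^ p) / (W (k ^ p))\<^sup>2)"
begin

lemma W_mono: "mono W"
  unfolding W_def by (intro monoI sum_mono2) (auto simp: \<sigma>_pos less_imp_le)

lemma W_pos: "1 \<le> N \<Longrightarrow> 0 < W N"
  unfolding W_def by (intro sum_pos) (auto simp: \<sigma>_pos)

text \<open>The means \<open>W n / n\<close> of a decreasing sequence decrease: each of the
  \<open>n - m\<close> later terms is at most \<open>\<sigma> m\<close>, and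
  \<open>m * \<sigma> m\<close> is at most \<open>W m\<close>.\<close>

lemma W_le:
  assumes "1 \<le> m" "m \<le> n"
  shows "W n / W m \<le> real n / real m"
proof -
  have "real m * \<sigma> m = (\<Sum>i=1..m. \<sigma> m)" by simp
  also have "\<dots> \<le> W m" unfolding W_def by (intro sum_mono \<sigma>_dec) (use assms in auto)
  finally have a: "real m * \<sigma> m \<le> W m" .
  have "{1..n} = {1..m} \<union> {m<..n}" using assms by auto
  then have "W n = W m + (\<Sum>i\<in>{m<..n}. \<sigma> i)"
    unfolding W_def by (subst sum.union_disjoint[symmetric]) auto
  also have "(\<Sum>i\<in>{m<..n}. \<sigma> i) \<le> (\<Sum>i\<in>{m<..n}. \<sigma> m)"
    by (intro sum_mono \<sigma>_dec) (use assms in auto)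
  finally have "W n \<le> W m + (real n - real m) * \<sigma> m" using assms by (simp add: of_nat_diff)
  then have "real m * W n \<le> real m * W m + (real n - real m) * (real m * \<sigma> m)"
    using mult_left_mono[of "W n" "W m + (real n - real m) * \<sigma> m" "real m"] by (simp add: algebra_simps)
  also have "\<dots> \<le> real m * W m + (real n - real m) * W m"
    using a assms by (intro add_left_mono mult_left_mono) auto
  finally show ?thesis using W_pos[OF assms(1)] assms(1) by (simp add: field_simps)
qed

lemma W_ratio: "(\<lambda>k. W (Suc k ^ p) / W (k ^ p)) \<longlonglongrightarrow> 1"
proof (rule tendsto_sandwich)
  show "eventually (\<lambda>k. 1 \<le> W (Suc k ^ p) / W (k ^ p)) sequentially"
    using eventually_ge_at_top[of 1]
  proof eventually_elim
    case (elim k)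
    then have "W (k ^ p) \<le> W (Suc k ^ p)" "0 < W (k ^ p)"
      by (auto intro!: monoD[OF W_mono] power_mono W_pos)
    then show ?case by simp
  qed
  show "eventually (\<lambda>k. W (Suc k ^ p) / W (k ^ p) \<le> (real (Suc k) / real k) ^ p) sequentially"
    using eventually_ge_at_top[of 1]
  proof eventually_elim
    case (elim k)
    then have "W (Suc k ^ p) / W (k ^ p) \<le> real (Suc k ^ p) / real (k ^ p)"
      by (intro W_le power_mono) auto
    then show ?case by (simp add: power_divide)
  qed
  have "(\<lambda>k. (real (Suc k) / real k) ^ p) \<longlonglongrightarrow> 1 ^ p"
    by (intro tendsto_power LIMSEQ_Suc_n_over_n)
  then show "(\<lambda>k. (real (Suc k) / real k) ^ p) \<longlonglongrightarrow> 1" by simp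
qed simp

text \<open>Summation by parts applied to \<open>b i - L\<close>. The hypothesis is exactly what
  \<open>birkhoff_bound\<close> supplies.\<close>

lemma tendsto_weighted_average:
  assumes B: "\<And>\<epsilon>::real. 0 < \<epsilon> \<Longrightarrow> \<exists>K. \<forall>n. \<bar>(\<Sum>i=1..n. b i) - real n * L\<bar> \<le> \<epsilon> * real n + K"
  shows "(\<lambda>N. (\<Sum>n=1..N. \<sigma> n * b n) / W N) \<longlonglongrightarrow> L"
proof (rule LIMSEQ_I)
  fix r :: real assume "0 < r"
  then obtain K where K: "\<And>n. \<bar>(\<Sum>i=1..n. b i) - real n * L\<bar> \<le> r / 2 * real n + K"
    using B[of "r / 2"] by auto
  then have K': "\<bar>\<Sum>i=1..n. b i - L\<bar> \<le> r / 2 * real n + K" for n by (simp add: sum_subtractf)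
  \<comment> \<open>Past this threshold the constant error \<open>K * \<sigma> 1\<close> is below
    \<open>r / 2 * W N\<close>.\<close>
  have "eventually (\<lambda>N. 2 * (K * \<sigma> 1) / r < W N) sequentially"
    using W_top by (simp add: filterlim_at_top_dense)
  then have "eventually (\<lambda>N. norm ((\<Sum>n=1..N. \<sigma> n * b n) / W N - L) < r) sequentially"
    using eventually_ge_at_top[of 1]
  proof eventually_elim
    case (elim N)
    note pos = W_pos[OF elim(2)]
    have "(\<Sum>n=1..N. \<sigma> n * b n) - L * W N = (\<Sum>n=1..N. \<sigma> n * (b n - L))"
      by (simp add: W_def algebra_simps sum_subtractf sum_distrib_left)
    also have "\<bar>\<dots>\<bar> \<le> r / 2 * (\<Sum>n=1..N. \<sigma> n) + K * \<sigma> 1"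
      by (rule abel_summation_bound[OF \<sigma>_dec less_imp_le[OF \<sigma>_pos] K' elim(2)])
    also have "\<dots> < r * W N"
      using elim(1) \<open>0 < r\<close> by (simp add: W_def field_simps)
    finally have "\<bar>(\<Sum>n=1..N. \<sigma> n * b n) - L * W N\<bar> / W N < r"
      using pos by (simp add: field_simps)
    moreover have "(\<Sum>n=1..N. \<sigma> n * b n) / W N - L = ((\<Sum>n=1..N. \<sigma> n * b n) - L * W N) / W N"
      using pos by (simp add: field_simps)
    ultimately show ?case using pos by simp
  qed
  then show "\<exists>no. \<forall>n\<ge>no. norm ((\<Sum>n=1..n. \<sigma> n * b n) / W n - L) < r"
    by (simp add: eventually_sequentially)
qed

end

lemma Lp_fun_2: "Lp_fun M 2 f \<longleftrightarrow> f \<in> borel_measurable M \<and> integrable M (\<lambda>x. (f x)\<^sup>2)"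
proof -
  have "\<bar>f x\<bar> powr 2 = (f x)\<^sup>2" for x by (cases "f x = 0") simp_all
  then show ?thesis by (simp add: Lp_fun_def)
qed

lemma Lp_fun_2_integrable:
  assumes "prob_space M" "Lp_fun M 2 f"
  shows "integrable M f"
proof -
  interpret prob_space M by fact
  show ?thesis
    by (rule square_integrable_imp_integrable) (use assms(2) in \<open>simp_all add: Lp_fun_2\<close>)
qed

context good_weights
begin

text \<open>Nonnegativity of \<open>f\<close> makes the weighted partial sums monotone, as the
  interpolation between powers requires. The general case follows by splitting \<open>f\<close> into
  its positive and negative parts.\<close>

lemma AE_weighted_average_nonneg:
  assumes sys: "measure_preserving_system M T" and f: "Lp_fun M 2 f" and f0: "\<And>x. 0 \<le> f x"
  shows "AE x in M. (\<lambda>N. (\<Sum>n=1..N. X n * f ((T ^^ n) x)) / W N)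
    \<longlonglongrightarrow> real_cond_exp M (invariant_algebra M T) f x"
proof -
  interpret mp_system M T by unfold_locales (rule sys)
  have f2: "integrable M (\<lambda>x. (f x)\<^sup>2)" and [measurable]: "f \<in> borel_measurable M"
    using f by (auto simp: Lp_fun_2)
  have int: "integrable M f" using Lp_fun_2_integrable[OF prob_space_axioms f] .
  \<comment> \<open>The difference between the averages weighted by \<open>X\<close> and by
    \<open>\<sigma>\<close> along the powers. Its squares have summable integrals, hence it tends to
    0 almost everywhere.\<close>
  define q where "q k x = (\<Sum>n=1..k^p. (X n - \<sigma> n) * f ((T ^^ n) x)) / W (k ^ p)" for k x
  have "AE x in M. summable (\<lambda>k. (q k x)\<^sup>2)"
  proof (rule AE_summable_integrals)
    show "integrable M (\<lambda>x. (q k x)\<^sup>2)" for k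
      unfolding q_def power_divide by (intro integrable_divide weighted_sum_L2 f2) auto
    show "(\<integral>x. (q k x)\<^sup>2 \<partial>M)
        \<le> correlation_sum (\<lambda>n. X n - \<sigma> n) (k ^ p) / (W (k ^ p))\<^sup>2 * (\<integral>x. (f x)\<^sup>2 \<partial>M)" for k
      using divide_right_mono[OF weighted_sum_L2(2)[OF _ f2, of "\<lambda>n. X n - \<sigma> n" "k ^ p"], of "(W (k ^ p))\<^sup>2"]
      by (simp add: q_def power_divide)
    show "summable (\<lambda>k. correlation_sum (\<lambda>n. X n - \<sigma> n) (k ^ p) / (W (k ^ p))\<^sup>2 * (\<integral>x. (f x)\<^sup>2 \<partial>M))"
      using summable_correlations by (rule summable_mult2)
  qed simp
  then show ?thesis
    using birkhoff_bound[OF int]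
  proof eventually_elim
    case (elim x)
    let ?L = "cexp f x"
    have "(\<lambda>k. sqrt ((q k x)\<^sup>2)) \<longlonglongrightarrow> sqrt 0"
      by (intro tendsto_real_sqrt summable_LIMSEQ_zero elim)
    then have q0: "(\<lambda>k. q k x) \<longlonglongrightarrow> 0" by (simp add: tendsto_rabs_zero_iff)
    have "(\<lambda>N. (\<Sum>n=1..N. \<sigma> n * f ((T ^^ n) x)) / W N) \<longlonglongrightarrow> ?L"
      by (rule tendsto_weighted_average) (use elim in blast)
    moreover have "filterlim (\<lambda>k::nat. k ^ p) sequentially sequentially"
    proof (rule filterlim_at_top_mono[OF filterlim_ident])
      have "k \<le> k ^ p" for k :: nat
        using power_increasing[of 1 p k] p by (cases "k = 0") auto
      then show "eventually (\<lambda>k::nat. k \<le> k ^ p) sequentially" by simp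
    qed
    ultimately have "(\<lambda>k. (\<Sum>n=1..k^p. \<sigma> n * f ((T ^^ n) x)) / W (k ^ p)) \<longlonglongrightarrow> ?L"
      by (rule filterlim_compose)
    from tendsto_add[OF q0 this]
    have lim: "(\<lambda>k. (\<Sum>n=1..k^p. X n * f ((T ^^ n) x)) / W (k ^ p)) \<longlonglongrightarrow> ?L"
      by (simp add: q_def left_diff_distrib sum_subtractf diff_divide_distrib)
    show ?case
    proof (rule tendsto_along_powers[OF _ _ W_mono W_pos p lim W_ratio])
      show "mono (\<lambda>N. \<Sum>n=1..N. X n * f ((T ^^ n) x))"
        by (intro monoI sum_mono2) (auto simp: X_nonneg f0)
      show "0 \<le> (\<Sum>n=1..N. X n * f ((T ^^ n) x))" for N
        by (intro sum_nonneg) (auto simp: X_nonneg f0)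
    qed
  qed
qed

lemma AE_weighted_average:
  assumes sys: "measure_preserving_system M T" and f: "Lp_fun M 2 f"
  shows "AE x in M. (\<lambda>N. (\<Sum>n=1..N. X n * f ((T ^^ n) x)) / W N)
    \<longlonglongrightarrow> real_cond_exp M (invariant_algebra M T) f x"
proof -
  interpret mp_system M T by unfold_locales (rule sys)
  define g h where "g x = max 0 (f x)" and "h x = max 0 (- f x)" for x
  have fm: "f \<in> borel_measurable M" "integrable M (\<lambda>x. (f x)\<^sup>2)" using f by (auto simp: Lp_fun_2)
  have "Lp_fun M 2 u" if "u \<in> borel_measurable M" "\<And>x. \<bar>u x\<bar> \<le> \<bar>f x\<bar>" for u
    unfolding Lp_fun_2
    by (intro conjI that Bochner_Integration.integrable_bound[OF fm(2)])
       (use that in \<open>auto simp flip: abs_le_square_iff\<close>)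
  note L2 = this
  have gh: "Lp_fun M 2 g" "Lp_fun M 2 h"
    by (auto intro!: L2 borel_measurable_max borel_measurable_uminus fm simp: g_def[abs_def] h_def[abs_def])
  have fgh: "f = (\<lambda>x. g x - h x)" by (auto simp: g_def h_def)
  have "AE x in M. cexp f x = cexp g x - cexp h x"
    unfolding fgh by (intro real_cond_exp_diff Lp_fun_2_integrable[OF prob_space_axioms] gh)
  moreover have "AE x in M. (\<lambda>N. (\<Sum>n=1..N. X n * g ((T ^^ n) x)) / W N) \<longlonglongrightarrow> cexp g x"
    by (rule AE_weighted_average_nonneg[OF sys gh(1)]) (simp add: g_def)
  moreover have "AE x in M. (\<lambda>N. (\<Sum>n=1..N. X n * h ((T ^^ n) x)) / W N) \<longlonglongrightarrow> cexp h x"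
    by (rule AE_weighted_average_nonneg[OF sys gh(2)]) (simp add: h_def)
  ultimately show ?thesis
  proof eventually_elim
    case (elim x)
    from tendsto_diff[OF elim(2,3)] show ?case
      unfolding elim(1) by (simp add: fgh right_diff_distrib sum_subtractf diff_divide_distrib)
  qed
qed

text \<open>On a one-point system with \<open>f = 1\<close> the convergence statement no longer
  depends on \<open>x\<close> and becomes a statement about the weights alone.\<close>

lemma sum_weights_asymp: "(\<lambda>N. (\<Sum>n=1..N. X n) / W N) \<longlonglongrightarrow> 1"
proof -
  define M where "M = return (count_space UNIV) ()"
  have sys: "measure_preserving_system M id"
    unfolding measure_preserving_system_def M_def
    by (intro conjI prob_space_return) (auto simp: space_return)
  interpret mp_system M id by unfold_locales (rule sys)
  have "AE x in M. cexp (\<lambda>_. 1) x = 1" by (rule real_cond_exp_F_meas) auto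
  moreover have "AE x in M. (\<lambda>N. (\<Sum>n=1..N. X n * 1) / W N) \<longlonglongrightarrow> cexp (\<lambda>_. 1) x"
    by (rule AE_weighted_average[OF sys, of "\<lambda>_. 1"]) (simp add: Lp_fun_2)
  ultimately have "AE x in M. (\<lambda>N. (\<Sum>n=1..N. X n) / W N) \<longlonglongrightarrow> 1"
    by eventually_elim simp
  then show ?thesis by simp
qed

end

section \<open>Return times and averages along them\<close>

lemma return_time_Suc:
  assumes "infinite (hitting_times S E y)"
  shows "return_time S E y n < return_time S E y (Suc n)"
    and "(S ^^ return_time S E y (Suc n)) y \<in> E (return_time S E y (Suc n))"
    and "\<And>k. return_time S E y n < k \<Longrightarrow> k < return_time S E y (Suc n) \<Longrightarrow> (S ^^ k) y \<notin> E k"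
proof -
  define B where "B = {k. return_time S E y n < k \<and> (S ^^ k) y \<in> E k}"
  \<comment> \<open>Infinitely many hits make the set under the infimum nonempty, so that the
    infimum is attained.\<close>
  obtain k where "k \<in> hitting_times S E y" "return_time S E y n < k"
    using assms unfolding infinite_nat_iff_unbounded by blast
  then have "B \<noteq> {}" by (auto simp: B_def hitting_times_def)
  then have "Inf B \<in> B" by (rule Inf_nat_def1)
  then show "return_time S E y n < return_time S E y (Suc n)"
    "(S ^^ return_time S E y (Suc n)) y \<in> E (return_time S E y (Suc n))"
    by (simp_all add: B_def)
  fix k assume "return_time S E y n < k" "k < return_time S E y (Suc n)"
  then show "(S ^^ k) y \<notin> E k"
    using cInf_lower[of k B] by (auto simp: B_def)
qed

text \<open>Converts weighted sums up to the N-th return time into sums along the return times. With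
  \<open>g = 1\<close> it says that exactly \<open>N\<close> hits have occurred by then.\<close>

lemma sum_return_time:
  fixes g :: "nat \<Rightarrow> real"
  assumes inf: "infinite (hitting_times S E y)"
  shows "(\<Sum>k=1..return_time S E y N. indicator (E k) ((S ^^ k) y) * g k)
    = (\<Sum>n=1..N. g (return_time S E y n))"
proof (induction N)
  case (Suc N)
  define r where "r = return_time S E y N"
  define r' where "r' = return_time S E y (Suc N)"
  note * = return_time_Suc[OF inf, of N, folded r_def r'_def]
  have split: "{1..r'} = {1..r} \<union> {r<..r'}" using *(1) by auto
  \<comment> \<open>Between two consecutive return times the only hit is the last index
    \<open>r'\<close>.\<close>
  have "(\<Sum>k\<in>{r<..r'}. indicator (E k) ((S ^^ k) y) * g k) = (\<Sum>k\<in>{r'}. g k)"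
    by (rule sum.mono_neutral_cong_right) (use * in \<open>auto simp: indicator_def\<close>)
  moreover have "(\<Sum>k=1..r'. indicator (E k) ((S ^^ k) y) * g k)
      = (\<Sum>k=1..r. indicator (E k) ((S ^^ k) y) * g k)
      + (\<Sum>k\<in>{r<..r'}. indicator (E k) ((S ^^ k) y) * g k)"
    unfolding split by (rule sum.union_disjoint) auto
  ultimately have "(\<Sum>k=1..r'. indicator (E k) ((S ^^ k) y) * g k)
      = (\<Sum>k=1..r. indicator (E k) ((S ^^ k) y) * g k) + g r'" by simp
  then show ?case using Suc unfolding r_def r'_def by (simp del: return_time.simps)
qed simp

lemma return_time_top:
  assumes "infinite (hitting_times S E y)"
  shows "filterlim (return_time S E y) sequentially sequentially"
  by (rule filterlim_subseq)
     (simp add: strict_mono_Suc_iff return_time_Suc(1)[OF assms] del: return_time.simps)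

text \<open>A point whose hit indicators form good weights. Only this one orbit enters, not the
  measure on the space of \<open>y\<close>.\<close>

locale good_point = good_weights "\<lambda>n. indicator (E n) ((S ^^ n) y)" \<sigma> W p
  for S :: "'y \<Rightarrow> 'y" and E :: "nat \<Rightarrow> 'y set" and y :: 'y and \<sigma> W :: "nat \<Rightarrow> real" and p :: nat
begin

text \<open>With finitely many hits the count divided by \<open>W\<close> would tend to 0, since
  \<open>W\<close> diverges, whereas its limit is 1.\<close>

lemma infinite_hitting_times: "infinite (hitting_times S E y)"
proof
  let ?X = "\<lambda>n. indicator (E n) ((S ^^ n) y) :: real"
  assume fin: "finite (hitting_times S E y)"
  define K where "K = real (card (hitting_times S E y))"
  have le: "(\<Sum>n=1..N. ?X n) \<le> K" for N
  proof -
    have "(\<Sum>n=1..N. ?X n) = (\<Sum>n\<in>hitting_times S E y \<inter> {1..N}. 1)"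
      by (rule sum.mono_neutral_cong_right) (auto simp: hitting_times_def indicator_def)
    also have "\<dots> \<le> K" unfolding K_def using fin by (simp add: card_mono)
    finally show ?thesis .
  qed
  have "(\<lambda>N. (\<Sum>n=1..N. ?X n) / W N) \<longlonglongrightarrow> 0"
  proof (rule tendsto_sandwich[OF _ _ tendsto_const])
    show "(\<lambda>N. K / W N) \<longlonglongrightarrow> 0"
      by (rule tendsto_divide_0[OF tendsto_const]) (rule filterlim_at_top_imp_at_infinity[OF W_top])
    show "eventually (\<lambda>N. (\<Sum>n=1..N. ?X n) / W N \<le> K / W N) sequentially"
      using eventually_ge_at_top[of 1]
      by eventually_elim (intro divide_right_mono le less_imp_le[OF W_pos])
    show "eventually (\<lambda>N. 0 \<le> (\<Sum>n=1..N. ?X n) / W N) sequentially"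
      using eventually_ge_at_top[of 1]
      by eventually_elim (intro divide_nonneg_pos W_pos sum_nonneg, auto)
  qed
  with sum_weights_asymp show False using LIMSEQ_unique by fastforce
qed

text \<open>Divide the weighted average by the normalized number of hits and restrict to the times
  \<open>return_time S E y N\<close>; there \<open>W\<close> cancels and the number of hits is
  \<open>N\<close>.\<close>

lemma AE_return_time_average:
  assumes sys: "measure_preserving_system M T" and f: "Lp_fun M 2 f"
  shows "AE x in M. (\<lambda>N. ergodic_average T f (return_time S E y) N x)
    \<longlonglongrightarrow> real_cond_exp M (invariant_algebra M T) f x"
  using AE_weighted_average[OF sys f]
proof eventually_elim
  case (elim x)
  let ?r = "return_time S E y"
  let ?X = "\<lambda>n. indicator (E n) ((S ^^ n) y) :: real"
  from tendsto_divide[OF elim sum_weights_asymp]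
  have "(\<lambda>N. (\<Sum>n=1..N. ?X n * f ((T ^^ n) x)) / W N / ((\<Sum>n=1..N. ?X n) / W N))
    \<longlonglongrightarrow> real_cond_exp M (invariant_algebra M T) f x" by simp
  then have "(\<lambda>N. (\<Sum>n=1..?r N. ?X n * f ((T ^^ n) x)) / W (?r N) / ((\<Sum>n=1..?r N. ?X n) / W (?r N)))
    \<longlonglongrightarrow> real_cond_exp M (invariant_algebra M T) f x"
    by (rule filterlim_compose[OF _ return_time_top[OF infinite_hitting_times]])
  moreover have "eventually (\<lambda>N.
      (\<Sum>n=1..?r N. ?X n * f ((T ^^ n) x)) / W (?r N) / ((\<Sum>n=1..?r N. ?X n) / W (?r N))
      = ergodic_average T f ?r N x) sequentially"
    using eventually_ge_at_top[of 1]
  proof eventually_elim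
    case (elim N)
    \<comment> \<open>\<open>W 0\<close> is 0, so the cancellation needs a positive index.\<close>
    have "1 \<le> ?r N"
      using elim return_time_Suc(1)[OF infinite_hitting_times, of "N - 1"] by (cases N) auto
    then have "0 < W (?r N)" by (rule W_pos)
    then show ?case
      using sum_return_time[OF infinite_hitting_times, where N = N and g = "\<lambda>n. f ((T ^^ n) x)"]
        sum_return_time[OF infinite_hitting_times, where N = N and g = "\<lambda>n. 1"]
      by (simp add: ergodic_average_def)
  qed
  ultimately show ?case by (rule Lim_transform_eventually)
qed

end

section \<open>Passing between almost everywhere limits and mean-square limits\<close>

context mp_system
begin

lemma ergodic_average_measurable [measurable]:
  assumes [measurable]: "f \<in> borel_measurable M"
  shows "ergodic_average T f s N \<in> borel_measurable M"
  unfolding ergodic_average_def by measurable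

text \<open>Cauchy-Schwarz over the \<open>N\<close> terms, all of which have the norm of
  \<open>f\<close> by invariance. The bound is uniform in \<open>N\<close> and in the sequence
  \<open>s\<close>.\<close>

lemma ergodic_average_L2:
  assumes [measurable]: "f \<in> borel_measurable M"
  shows "(\<integral>\<^sup>+x. ennreal ((ergodic_average T f s N x)\<^sup>2) \<partial>M) \<le> (\<integral>\<^sup>+x. ennreal ((f x)\<^sup>2) \<partial>M)"
proof (cases "N = 0")
  case False
  have "(\<integral>\<^sup>+x. ennreal ((ergodic_average T f s N x)\<^sup>2) \<partial>M)
      \<le> (\<integral>\<^sup>+x. ennreal (1 / real N) * (\<Sum>n=1..N. ennreal ((f ((T ^^ s n) x))\<^sup>2)) \<partial>M)"
  proof (rule nn_integral_mono)
    fix x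
    have "(ergodic_average T f s N x)\<^sup>2 \<le> ((\<Sum>n=1..N. (f ((T ^^ s n) x))\<^sup>2) * real N) / (real N)\<^sup>2"
      unfolding ergodic_average_def power_divide
      using sum_squared_le_sum_of_squares[of "\<lambda>n. f ((T ^^ s n) x)" "{1..N}"]
      by (intro divide_right_mono) simp_all
    also have "\<dots> = 1 / real N * (\<Sum>n=1..N. (f ((T ^^ s n) x))\<^sup>2)"
      using False by (simp add: power2_eq_square)
    finally show "ennreal ((ergodic_average T f s N x)\<^sup>2)
      \<le> ennreal (1 / real N) * (\<Sum>n=1..N. ennreal ((f ((T ^^ s n) x))\<^sup>2))"
      by (subst sum_ennreal) (auto simp flip: ennreal_mult intro!: ennreal_leI sum_nonneg simp: ennreal_mult'[symmetric])
  qed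
  also have "\<dots> = ennreal (1 / real N) * (\<Sum>n=1..N. \<integral>\<^sup>+x. ennreal ((f ((T ^^ s n) x))\<^sup>2) \<partial>M)"
    by (simp add: nn_integral_cmult nn_integral_sum del: sum_ennreal)
  also have "\<dots> = ennreal (1 / real N) * (of_nat N * (\<integral>\<^sup>+x. ennreal ((f x)\<^sup>2) \<partial>M))"
    using nn_integral_funpow[of "\<lambda>x. ennreal ((f x)\<^sup>2)"] by simp
  also have "\<dots> = (\<integral>\<^sup>+x. ennreal ((f x)\<^sup>2) \<partial>M)"
    using False by (simp add: mult.assoc[symmetric] ennreal_of_nat_eq_real_of_nat ennreal_mult'[symmetric])
  finally show ?thesis .
qed (simp add: ergodic_average_def)

text \<open>Split \<open>f\<close> into a truncation \<open>h K\<close> and a remainder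
  \<open>g K\<close>. Dominated convergence handles the bounded part; the remainder is small in mean
  square, uniformly in \<open>N\<close>, because averaging is a contraction.\<close>

lemma L2_limit_of_AE_limit:
  assumes conv: "\<And>f. Lp_fun M 2 f \<Longrightarrow> AE x in M. (\<lambda>N. ergodic_average T f s N x) \<longlonglongrightarrow> cexp f x"
    and f: "Lp_fun M 2 f"
  shows "(\<lambda>N. \<integral>\<^sup>+x. ennreal ((ergodic_average T f s N x - cexp f x)\<^sup>2) \<partial>M) \<longlonglongrightarrow> 0"
proof -
  have [measurable]: "f \<in> borel_measurable M" and f2: "integrable M (\<lambda>x. (f x)\<^sup>2)"
    using f by (auto simp: Lp_fun_2)
  have [measurable]: "cexp u \<in> borel_measurable M" for u by simp
  define h where "h K x = max (- real K) (min (real K) (f x))" for K :: nat and x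
  define g where "g K x = f x - h K x" for K x
  have [measurable]: "h K \<in> borel_measurable M" "g K \<in> borel_measurable M" for K
    by (simp_all add: h_def[abs_def] g_def[abs_def])
  have h_le: "\<bar>h K x\<bar> \<le> real K" for K x by (auto simp: h_def)
  have g_le: "\<bar>g K x\<bar> \<le> \<bar>f x\<bar>" for K x by (auto simp: g_def h_def)
  have h_le_f: "\<bar>h K x\<bar> \<le> \<bar>f x\<bar>" for K x by (auto simp: h_def)
  have L2: "Lp_fun M 2 u" if "u \<in> borel_measurable M" "\<And>x. \<bar>u x\<bar> \<le> \<bar>f x\<bar>" for u
    unfolding Lp_fun_2
    by (intro conjI that Bochner_Integration.integrable_bound[OF f2])
       (use that in \<open>auto simp flip: abs_le_square_iff\<close>)
  have gL2: "Lp_fun M 2 (g K)" and hL2: "Lp_fun M 2 (h K)" for K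
    using g_le h_le_f by (auto intro!: L2)
  define G where "G K = (\<integral>\<^sup>+x. ennreal ((g K x)\<^sup>2) \<partial>M)" for K
  have G0: "G \<longlonglongrightarrow> 0"
  proof -
    have "(\<lambda>K. \<integral>\<^sup>+x. ennreal ((g K x)\<^sup>2) \<partial>M) \<longlonglongrightarrow> (\<integral>\<^sup>+x. 0 \<partial>M)"
    proof (rule nn_integral_dominated_convergence[where w = "\<lambda>x. ennreal ((f x)\<^sup>2)"])
      show "AE x in M. ennreal ((g K x)\<^sup>2) \<le> ennreal ((f x)\<^sup>2)" for K
        using g_le by (auto intro!: AE_I2 ennreal_leI simp flip: abs_le_square_iff)
      show "(\<integral>\<^sup>+x. ennreal ((f x)\<^sup>2) \<partial>M) < \<infinity>"
        using f2 by (simp add: nn_integral_eq_integral)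
      show "AE x in M. (\<lambda>K. ennreal ((g K x)\<^sup>2)) \<longlonglongrightarrow> 0"
      proof (rule AE_I2)
        fix x
        have "eventually (\<lambda>K. ennreal ((g K x)\<^sup>2) = 0) sequentially"
          using eventually_ge_at_top[of "nat \<lceil>\<bar>f x\<bar>\<rceil>"]
        proof eventually_elim
          case (elim K)
          then have "\<bar>f x\<bar> \<le> real K" by linarith
          then show ?case by (simp add: g_def h_def)
        qed
        then show "(\<lambda>K. ennreal ((g K x)\<^sup>2)) \<longlonglongrightarrow> 0" by (rule tendsto_eventually)
      qed
    qed auto
    then show ?thesis by (simp add: G_def[abs_def])
  qed
  have avg_g: "(\<integral>\<^sup>+x. ennreal ((ergodic_average T (g K) s N x)\<^sup>2) \<partial>M) \<le> G K" for K N
    unfolding G_def by (rule ergodic_average_L2) simp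
  \<comment> \<open>By the assumed convergence \<open>cexp (g K)\<close> is a pointwise limit of
    averages, so Fatou's lemma transfers the contraction bound to it.\<close>
  have cexp_g: "(\<integral>\<^sup>+x. ennreal ((cexp (g K) x)\<^sup>2) \<partial>M) \<le> G K" for K
  proof -
    have "(\<integral>\<^sup>+x. ennreal ((cexp (g K) x)\<^sup>2) \<partial>M)
        = (\<integral>\<^sup>+x. liminf (\<lambda>N. ennreal ((ergodic_average T (g K) s N x)\<^sup>2)) \<partial>M)"
      by (rule nn_integral_cong_AE, rule AE_mp[OF conv[OF gL2[of K]]])
         (auto intro!: AE_I2 lim_imp_Liminf[symmetric] tendsto_intros)
    also have "\<dots> \<le> liminf (\<lambda>N. \<integral>\<^sup>+x. ennreal ((ergodic_average T (g K) s N x)\<^sup>2) \<partial>M)"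
      by (rule nn_integral_liminf) simp
    also have "\<dots> \<le> limsup (\<lambda>N. \<integral>\<^sup>+x. ennreal ((ergodic_average T (g K) s N x)\<^sup>2) \<partial>M)"
      by (rule Liminf_le_Limsup) simp
    also have "\<dots> \<le> G K" by (rule Limsup_bounded) (simp add: avg_g)
    finally show ?thesis .
  qed
  define H where "H K N = (\<integral>\<^sup>+x. ennreal ((ergodic_average T (h K) s N x - cexp (h K) x)\<^sup>2) \<partial>M)" for K N
  have H0: "H K \<longlonglongrightarrow> 0" for K
  proof -
    have avg_le: "\<bar>ergodic_average T (h K) s N x\<bar> \<le> real K" for N x
    proof (cases "N = 0")
      case False
      have "\<bar>\<Sum>n=1..N. h K ((T ^^ s n) x)\<bar> \<le> (\<Sum>n=1..N. \<bar>h K ((T ^^ s n) x)\<bar>)" by (rule sum_abs)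
      also have "\<dots> \<le> (\<Sum>n=1..N. real K)" by (intro sum_mono h_le)
      finally show ?thesis using False by (simp add: ergodic_average_def field_simps)
    qed (simp add: ergodic_average_def)
    have "(\<lambda>N. \<integral>\<^sup>+x. ennreal ((ergodic_average T (h K) s N x - cexp (h K) x)\<^sup>2) \<partial>M) \<longlonglongrightarrow> (\<integral>\<^sup>+x. 0 \<partial>M)"
    proof (rule nn_integral_dominated_convergence[where w = "\<lambda>x. ennreal ((2 * real K)\<^sup>2)"])
      show "AE x in M. ennreal ((ergodic_average T (h K) s N x - cexp (h K) x)\<^sup>2) \<le> ennreal ((2 * real K)\<^sup>2)" for N
        using conv[OF hL2[of K]]
      proof eventually_elim
        case (elim x)
        \<comment> \<open>The conditional expectation inherits the bound \<open>K\<close> as a limit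
          of averages bounded by \<open>K\<close>.\<close>
        have "\<bar>cexp (h K) x\<bar> \<le> real K"
          by (rule LIMSEQ_le_const2[OF tendsto_rabs[OF elim]]) (simp add: avg_le)
        with avg_le[of N x] have "\<bar>ergodic_average T (h K) s N x - cexp (h K) x\<bar> \<le> \<bar>2 * real K\<bar>" by linarith
        then show ?case by (intro ennreal_leI) (simp only: abs_le_square_iff)
      qed
      show "AE x in M. (\<lambda>N. ennreal ((ergodic_average T (h K) s N x - cexp (h K) x)\<^sup>2)) \<longlonglongrightarrow> 0"
        using conv[OF hL2[of K]]
      proof eventually_elim
        case (elim x)
        have "(\<lambda>N. ennreal ((ergodic_average T (h K) s N x - cexp (h K) x)\<^sup>2)) \<longlonglongrightarrow> ennreal ((cexp (h K) x - cexp (h K) x)\<^sup>2)"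
          by (intro tendsto_intros elim)
        then show ?case by simp
      qed
    qed (auto simp: emeasure_space_1)
    then show ?thesis by (simp add: H_def[abs_def])
  qed
  have main: "(\<integral>\<^sup>+x. ennreal ((ergodic_average T f s N x - cexp f x)\<^sup>2) \<partial>M) \<le> 3 * H K N + 6 * G K" for K N
  proof -
    have "AE x in M. cexp (\<lambda>x. h K x + g K x) x = cexp (h K) x + cexp (g K) x"
      by (intro real_cond_exp_add Lp_fun_2_integrable[OF prob_space_axioms] gL2 hL2)
    then have ce: "AE x in M. cexp f x = cexp (h K) x + cexp (g K) x" by (simp add: g_def)
    have "(\<integral>\<^sup>+x. ennreal ((ergodic_average T f s N x - cexp f x)\<^sup>2) \<partial>M)
      \<le> (\<integral>\<^sup>+x. 3 * ennreal ((ergodic_average T (h K) s N x - cexp (h K) x)\<^sup>2)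
          + 3 * ennreal ((ergodic_average T (g K) s N x)\<^sup>2) + 3 * ennreal ((cexp (g K) x)\<^sup>2) \<partial>M)"
    proof (rule nn_integral_mono_AE, use ce in eventually_elim)
      case (elim x)
      define a b c where "a = ergodic_average T (h K) s N x - cexp (h K) x"
        and "b = ergodic_average T (g K) s N x" and "c = cexp (g K) x"
      have "ergodic_average T f s N x = ergodic_average T (h K) s N x + ergodic_average T (g K) s N x"
        by (simp add: ergodic_average_def g_def sum_subtractf diff_divide_distrib)
      then have "ergodic_average T f s N x - cexp f x = a + b - c"
        using elim by (simp add: a_def b_def c_def)
      moreover have "(a + b - c)\<^sup>2 \<le> 3 * a\<^sup>2 + 3 * b\<^sup>2 + 3 * c\<^sup>2"
      proof -
        have "0 \<le> (a - b)\<^sup>2 + (a + c)\<^sup>2 + (b + c)\<^sup>2" by simp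
        then show ?thesis by (simp add: power2_eq_square algebra_simps)
      qed
      ultimately have "ennreal ((ergodic_average T f s N x - cexp f x)\<^sup>2) \<le> ennreal (3 * a\<^sup>2 + 3 * b\<^sup>2 + 3 * c\<^sup>2)"
        by (metis ennreal_leI)
      also have "\<dots> = 3 * ennreal (a\<^sup>2) + 3 * ennreal (b\<^sup>2) + 3 * ennreal (c\<^sup>2)"
        by (simp add: ennreal_mult)
      finally show ?case by (simp add: a_def b_def c_def)
    qed
    also have "\<dots> = 3 * H K N + 3 * (\<integral>\<^sup>+x. ennreal ((ergodic_average T (g K) s N x)\<^sup>2) \<partial>M)
        + 3 * (\<integral>\<^sup>+x. ennreal ((cexp (g K) x)\<^sup>2) \<partial>M)"
      by (simp add: nn_integral_add nn_integral_cmult H_def)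
    also have "\<dots> \<le> 3 * H K N + 3 * G K + 3 * G K"
      by (intro add_mono mult_left_mono avg_g cexp_g order_refl) auto
    also have "\<dots> = 3 * H K N + (3 + 3) * G K" by (simp only: distrib_right add.assoc)
    finally show ?thesis by simp
  qed
  show ?thesis
  proof (rule order_tendstoI)
    fix e :: ennreal assume "0 < e"
    then obtain d where d: "0 < d" "d < e" using dense by blast
    then obtain r where r: "d = ennreal r" "0 < r"
      by (cases d) (auto simp: ennreal_less_zero_iff)
    define d' where "d' = ennreal (r / 2)"
    have d': "0 < d'" "d' + d' = d" using r by (simp_all add: d'_def flip: ennreal_plus)
    \<comment> \<open>\<open>K\<close> is fixed first, by the remainder; only then is
      \<open>N\<close> taken large for the truncation with this \<open>K\<close>.\<close>
    have "(\<lambda>K. 6 * G K) \<longlonglongrightarrow> 6 * 0" by (intro ennreal_tendsto_cmult G0) simp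
    then have "eventually (\<lambda>K. 6 * G K < d') sequentially"
      using d' by (intro order_tendstoD(2)[where y = 0]) simp_all
    then obtain K where K: "6 * G K < d'" by (auto simp: eventually_sequentially)
    have "(\<lambda>N. 3 * H K N) \<longlonglongrightarrow> 3 * 0" by (intro ennreal_tendsto_cmult H0) simp
    then have "eventually (\<lambda>N. 3 * H K N < d') sequentially"
      using d' by (intro order_tendstoD(2)[where y = 0]) simp_all
    then show "eventually (\<lambda>N. (\<integral>\<^sup>+x. ennreal ((ergodic_average T f s N x - cexp f x)\<^sup>2) \<partial>M) < e) sequentially"
    proof eventually_elim
      case (elim N)
      have "3 * H K N + 6 * G K \<le> d' + d'"
        using elim K by (intro add_mono) auto
      also have "\<dots> = d" by (rule d')
      finally show ?case using main[of N K] d(2) by (meson le_less_trans order_trans)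
    qed
  qed simp
qed

text \<open>The limit form, needed to identify the conditional expectations of a system and of its
  factor.\<close>

lemma birkhoff:
  assumes "integrable M f"
  shows "AE x in M. (\<lambda>N. ergodic_average T f (\<lambda>n. n) N x) \<longlonglongrightarrow> cexp f x"
  using birkhoff_bound[OF assms]
proof eventually_elim
  case (elim x)
  show ?case
  proof (rule LIMSEQ_I)
    fix r :: real assume "0 < r"
    then obtain K where K: "\<And>n. \<bar>(\<Sum>i=1..n. f ((T ^^ i) x)) - real n * cexp f x\<bar> \<le> r / 2 * real n + K"
      using elim half_gt_zero by blast
    have "norm (ergodic_average T f (\<lambda>n. n) n x - cexp f x) < r" if n: "n \<ge> nat \<lceil>2 * K / r\<rceil> + 1" for n
    proof -
      have pos: "0 < real n" using n by simp
      have "2 * K / r < real n" using n by linarith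
      then have "r / 2 * real n + K < r * real n" using \<open>0 < r\<close> by (simp add: field_simps)
      with K[of n] have "\<bar>(\<Sum>i=1..n. f ((T ^^ i) x)) - real n * cexp f x\<bar> / real n < r"
        using pos by (simp add: field_simps)
      moreover have "ergodic_average T f (\<lambda>n. n) n x - cexp f x
          = ((\<Sum>i=1..n. f ((T ^^ i) x)) - real n * cexp f x) / real n"
        using pos by (simp add: ergodic_average_def field_simps)
      ultimately show ?thesis using pos by simp
    qed
    then show "\<exists>no. \<forall>n\<ge>no. norm (ergodic_average T f (\<lambda>n. n) n x - cexp f x) < r" by blast
  qed
qed

text \<open>By Fatou the lower limit of the squared distances to \<open>cexp f\<close> has integral
  0. Where the averages converge, that lower limit is the squared distance of their limit from
  \<open>cexp f\<close>.\<close>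

lemma AE_limit_of_L2_limit:
  assumes "f \<in> borel_measurable M"
    and conv: "AE x in M. convergent (\<lambda>N. ergodic_average T f s N x)"
    and L2: "(\<lambda>N. \<integral>\<^sup>+x. ennreal ((ergodic_average T f s N x - cexp f x)\<^sup>2) \<partial>M) \<longlonglongrightarrow> 0"
  shows "AE x in M. (\<lambda>N. ergodic_average T f s N x) \<longlonglongrightarrow> cexp f x"
proof -
  note [measurable] = assms(1)
  have [measurable]: "cexp f \<in> borel_measurable M" by simp
  let ?d = "\<lambda>N x. ennreal ((ergodic_average T f s N x - cexp f x)\<^sup>2)"
  have "(\<integral>\<^sup>+x. liminf (\<lambda>N. ?d N x) \<partial>M) \<le> liminf (\<lambda>N. \<integral>\<^sup>+x. ?d N x \<partial>M)"
    by (rule nn_integral_liminf) simp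
  also have "\<dots> = 0" using L2 by (intro lim_imp_Liminf) auto
  finally have "(\<integral>\<^sup>+x. liminf (\<lambda>N. ?d N x) \<partial>M) = 0" by simp
  then have "AE x in M. liminf (\<lambda>N. ?d N x) = 0"
    by (subst (asm) nn_integral_0_iff_AE) auto
  with conv show ?thesis
  proof eventually_elim
    case (elim x)
    then obtain l where l: "(\<lambda>N. ergodic_average T f s N x) \<longlonglongrightarrow> l" by (auto simp: convergent_def)
    have "(\<lambda>N. ?d N x) \<longlonglongrightarrow> ennreal ((l - cexp f x)\<^sup>2)" by (intro tendsto_intros l)
    then have "ennreal ((l - cexp f x)\<^sup>2) = 0" using elim lim_imp_Liminf[of sequentially] by force
    then have "l = cexp f x" by simp
    with l show ?case by simp
  qed
qed

text \<open>Sending \<open>x\<close> to the orbit \<open>(f (T\<^sup>n x))\<close> makes the shift on real sequences a factor of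
  \<open>T\<close>; the two conditional expectations agree because both are limits of Birkhoff averages.\<close>

lemma AE_average_transfer:
  assumes good: "pointwise_universally_good TYPE(nat \<Rightarrow> real) 2 s"
    and erg: "ergodic_sequence TYPE(nat \<Rightarrow> real) s"
    and f: "Lp_fun M 2 f"
  shows "AE x in M. (\<lambda>N. ergodic_average T f s N x) \<longlonglongrightarrow> cexp f x"
proof -
  have [measurable]: "f \<in> borel_measurable M" and f2: "integrable M (\<lambda>x. (f x)\<^sup>2)"
    using f by (auto simp: Lp_fun_2)
  \<comment> \<open>The points of the factor have type \<open>nat \<Rightarrow> real\<close>
    whatever the type of the points of \<open>M\<close>, so the hypotheses at this one type apply to
    it.\<close>
  define P where "P = (\<Pi>\<^sub>M i\<in>(UNIV :: nat set). (borel :: real measure))"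
  define \<phi> where "\<phi> x = (\<lambda>n. f ((T ^^ n) x))" for x
  define M' where "M' = distr M P \<phi>"
  define \<tau> :: "(nat \<Rightarrow> real) \<Rightarrow> nat \<Rightarrow> real" where "\<tau> \<omega> = (\<lambda>n. \<omega> (Suc n))" for \<omega>
  define \<pi> :: "(nat \<Rightarrow> real) \<Rightarrow> real" where "\<pi> \<omega> = \<omega> 0" for \<omega>
  have \<phi>[measurable]: "\<phi> \<in> measurable M P"
    unfolding \<phi>_def P_def by (rule measurable_abs_UNIV) simp
  have \<tau>[measurable]: "\<tau> \<in> measurable P P"
    unfolding \<tau>_def P_def by (rule measurable_abs_UNIV) simp
  have \<pi>[measurable]: "\<pi> \<in> borel_measurable P"
    unfolding \<pi>_def P_def by simp
  have spaceP: "space P = UNIV" by (auto simp: P_def space_PiM)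
  have \<phi>T: "\<tau> (\<phi> x) = \<phi> (T x)" for x
    by (simp add: \<tau>_def \<phi>_def funpow_swap1)
  have pow: "(\<tau> ^^ k) (\<phi> x) = \<phi> ((T ^^ k) x)" for k x
    by (induction k) (simp_all add: \<phi>T)
  have sys': "measure_preserving_system M' \<tau>"
    unfolding measure_preserving_system_def
  proof (intro conjI ballI)
    show "prob_space M'" unfolding M'_def by (rule prob_space_distr) simp
    show "\<tau> \<in> measurable M' M'" unfolding M'_def by simp
    fix A assume "A \<in> sets M'"
    then have A[measurable]: "A \<in> sets P" by (simp add: M'_def)
    have B: "\<phi> -` A \<inter> space M \<in> sets M" by measurable
    have "emeasure M' (\<tau> -` A \<inter> space M') = emeasure M (\<phi> -` (\<tau> -` A \<inter> space P) \<inter> space M)"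
      unfolding M'_def by (subst emeasure_distr) (auto intro: measurable_sets[OF \<tau>])
    also have "\<phi> -` (\<tau> -` A \<inter> space P) \<inter> space M = T -` (\<phi> -` A \<inter> space M) \<inter> space M"
      by (auto simp: \<phi>T spaceP T_space)
    also have "emeasure M \<dots> = emeasure M (\<phi> -` A \<inter> space M)"
      using system B unfolding measure_preserving_system_def by blast
    also have "\<dots> = emeasure M' A"
      unfolding M'_def by (rule emeasure_distr[symmetric]) auto
    finally show "emeasure M' (\<tau> -` A \<inter> space M') = emeasure M' A" .
  qed
  interpret F: mp_system M' \<tau> by unfold_locales (rule sys')
  have \<pi>L2: "Lp_fun M' 2 \<pi>"
  proof -
    have "integrable M' (\<lambda>\<omega>. (\<pi> \<omega>)\<^sup>2)"
      unfolding M'_def by (subst integrable_distr_eq) (simp_all, simp add: \<pi>_def \<phi>_def f2)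
    then show ?thesis by (simp add: Lp_fun_2 M'_def)
  qed
  have avg: "ergodic_average \<tau> \<pi> u N (\<phi> x) = ergodic_average T f u N x" for u N x
    by (simp add: ergodic_average_def pow) (simp add: \<pi>_def \<phi>_def)
  have pull: "AE x in M. (\<lambda>N. ergodic_average T f u N x) \<longlonglongrightarrow> c (\<phi> x)"
    if "AE \<omega> in M'. (\<lambda>N. ergodic_average \<tau> \<pi> u N \<omega>) \<longlonglongrightarrow> c \<omega>" for u c
    using AE_distrD[OF \<phi> that[unfolded M'_def]] by (simp add: avg)
  have "AE \<omega> in M'. (\<lambda>N. ergodic_average \<tau> \<pi> s N \<omega>) \<longlonglongrightarrow> F.cexp \<pi> \<omega>"
  proof (rule F.AE_limit_of_L2_limit)
    show "AE \<omega> in M'. convergent (\<lambda>N. ergodic_average \<tau> \<pi> s N \<omega>)"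
      using good sys' \<pi>L2 by (auto simp: pointwise_universally_good_def)
    show "(\<lambda>N. \<integral>\<^sup>+\<omega>. ennreal ((ergodic_average \<tau> \<pi> s N \<omega> - F.cexp \<pi> \<omega>)\<^sup>2) \<partial>M') \<longlonglongrightarrow> 0"
      using erg sys' \<pi>L2 by (auto simp: ergodic_sequence_def)
  qed (use \<pi>L2 in \<open>simp add: Lp_fun_2\<close>)
  then have "AE x in M. (\<lambda>N. ergodic_average T f s N x) \<longlonglongrightarrow> F.cexp \<pi> (\<phi> x)"
    by (rule pull)
  moreover have "AE x in M. (\<lambda>N. ergodic_average T f (\<lambda>n. n) N x) \<longlonglongrightarrow> F.cexp \<pi> (\<phi> x)"
    by (rule pull, rule F.birkhoff[OF Lp_fun_2_integrable[OF F.prob_space_axioms \<pi>L2]])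
  ultimately show ?thesis
    using birkhoff[OF Lp_fun_2_integrable[OF prob_space_axioms f]]
  proof eventually_elim
    case (elim x)
    have "F.cexp \<pi> (\<phi> x) = cexp f x" by (rule LIMSEQ_unique[OF elim(2,3)])
    with elim(1) show ?case by simp
  qed
qed

end

lemma universally_good_of_AE_limit:
  assumes "\<And>(M :: 'b measure) T f. measure_preserving_system M T \<Longrightarrow> Lp_fun M 2 f \<Longrightarrow>
    AE x in M. (\<lambda>N. ergodic_average T f s N x) \<longlonglongrightarrow> real_cond_exp M (invariant_algebra M T) f x"
  shows "pointwise_universally_good TYPE('b) 2 s" "ergodic_sequence TYPE('b) s"
proof -
  show "pointwise_universally_good TYPE('b) 2 s"
    unfolding pointwise_universally_good_def
  proof (intro allI impI)
    fix M :: "'b measure" and T f assume "measure_preserving_system M T" "Lp_fun M 2 f"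
    from assms[OF this] show "AE x in M. convergent (\<lambda>N. ergodic_average T f s N x)"
      by eventually_elim (rule convergentI)
  qed
  show "ergodic_sequence TYPE('b) s"
    unfolding ergodic_sequence_def
  proof (intro allI impI)
    fix M :: "'b measure" and T f assume sys: "measure_preserving_system M T" and f: "Lp_fun M 2 f"
    interpret mp_system M T by unfold_locales (rule sys)
    show "(\<lambda>N. \<integral>\<^sup>+x. ennreal ((ergodic_average T f s N x
        - real_cond_exp M (invariant_algebra M T) f x)\<^sup>2) \<partial>M) \<longlonglongrightarrow> 0"
      by (rule L2_limit_of_AE_limit[OF assms[OF sys] f])
  qed
qed

subsection \<open>Correlations of the centred hits\<close>

text \<open>\<open>R\<close> bounds the partial sums of \<open>\<rho>\<close>. The measures
  \<open>\<sigma>\<close> are only positive and decreasing here; the power law enters later, through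
  a lower bound on their sums.\<close>

locale decaying_targets = mp_system Y S
  for Y :: "'a measure" and S :: "'a \<Rightarrow> 'a" +
  fixes E :: "nat \<Rightarrow> 'a set" and \<rho> \<sigma> :: "nat \<Rightarrow> real" and C R :: real
  assumes E_sets [measurable]: "E n \<in> sets Y"
    and decay: "1 \<le> n \<Longrightarrow> 1 \<le> m \<Longrightarrow> integrable Y g \<Longrightarrow>
      AE y in Y. y \<notin> (\<Union>k\<in>{1..}. E k) \<longrightarrow> g y = 0 \<Longrightarrow>
      \<bar>(LINT y:E n|Y. g ((S ^^ m) y)) - prob (E n) * (LINT y|Y. g y)\<bar> \<le> C * \<rho> m * (LINT y|Y. \<bar>g y\<bar>)"
    and C: "0 < C"
    and \<rho>_nonneg: "1 \<le> n \<Longrightarrow> 0 \<le> \<rho> n"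
    and \<rho>_dec: "1 \<le> m \<Longrightarrow> m \<le> n \<Longrightarrow> \<rho> n \<le> \<rho> m"
    and \<rho>_sum: "(\<Sum>n=1..N. \<rho> n) \<le> R"
    and \<sigma>: "1 \<le> n \<Longrightarrow> prob (E n) = \<sigma> n"
    and \<sigma>_pos: "1 \<le> n \<Longrightarrow> 0 < \<sigma> n"
    and \<sigma>_dec: "1 \<le> m \<Longrightarrow> m \<le> n \<Longrightarrow> \<sigma> n \<le> \<sigma> m"
begin

definition X :: "nat \<Rightarrow> 'a \<Rightarrow> real" where
  "X n y = indicator (E n) ((S ^^ n) y)"

definition Z :: "nat \<Rightarrow> 'a \<Rightarrow> real" where
  "Z n y = X n y - \<sigma> n"

lemma X_cases: "X n y = 0 \<or> X n y = 1"
  by (auto simp: X_def indicator_def)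

lemma X_bounds: "0 \<le> X n y" "X n y \<le> 1"
  by (auto simp: X_def indicator_def)

lemma X_measurable [measurable]: "X n \<in> borel_measurable Y"
  unfolding X_def by measurable

lemma Z_measurable [measurable]: "Z n \<in> borel_measurable Y"
  unfolding Z_def by measurable

lemma \<sigma>_le_1: "1 \<le> n \<Longrightarrow> \<sigma> n \<le> 1"
  using \<sigma>[of n] prob_le_1 by metis

lemma Z_le: "1 \<le> n \<Longrightarrow> \<bar>Z n y\<bar> \<le> 1"
  using X_cases[of n y] \<sigma>_pos[of n] \<sigma>_le_1[of n] by (auto simp: Z_def)

lemma integrable_X2: "integrable Y (\<lambda>y. X i y * X j y)"
  by (rule integrable_const_bound[where B = 1])
     (auto simp: X_def indicator_def intro!: AE_I2)

lemma integrable_X3: "integrable Y (\<lambda>y. X i y * X j y * X k y)"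
  by (rule integrable_const_bound[where B = 1])
     (auto simp: X_def indicator_def intro!: AE_I2)

lemma integrable_X4: "integrable Y (\<lambda>y. X i y * (X j y * X k y * X l y))"
  by (rule integrable_const_bound[where B = 1])
     (auto simp: X_def indicator_def intro!: AE_I2)

lemma integrable_X: "integrable Y (X i)"
  by (rule integrable_const_bound[where B = 1])
     (auto simp: X_def indicator_def intro!: AE_I2)

lemma integrable_ZX3:
  assumes "1 \<le> i" shows "integrable Y (\<lambda>y. Z i y * (X j y * X k y * X l y))"
  unfolding Z_def left_diff_distrib using integrable_X4 integrable_X3 by simp

lemma expectation_X: "1 \<le> n \<Longrightarrow> expectation (X n) = \<sigma> n"
  using integral_funpow[of "indicator (E n)" n] by (simp add: X_def[abs_def] \<sigma>)

section \<open>Decay for products of hits\<close>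

text \<open>Moving the product of the three later hits back by \<open>j\<close> steps gives a
  function \<open>g\<close> that vanishes off \<open>E j\<close>, so decay applies to it at gap
  \<open>j - i\<close>. Equal indices are allowed and, as each \<open>X\<close> is idempotent, give
  products of fewer hits.\<close>

lemma decay_product:
  assumes "1 \<le> i" "i < j" "j \<le> k" "j \<le> l"
  shows "\<bar>expectation (\<lambda>y. X i y * (X j y * X k y * X l y)) - \<sigma> i * expectation (\<lambda>y. X j y * X k y * X l y)\<bar>
    \<le> C * \<rho> (j - i) * expectation (\<lambda>y. X j y * X k y * X l y)"
proof -
  define g where "g y = indicator (E j) y * indicator (E k) ((S ^^ (k - j)) y)
    * (indicator (E l) ((S ^^ (l - j)) y) :: real)" for y
  have [measurable]: "g \<in> borel_measurable Y" unfolding g_def by measurable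
  have gj: "g ((S ^^ j) y) = X j y * X k y * X l y" for y
    using assms by (simp add: g_def X_def flip: funpow_add[unfolded o_def fun_eq_iff, rule_format])
  have int_g: "expectation g = expectation (\<lambda>y. X j y * X k y * X l y)"
    using integral_funpow[of g j] by (simp add: gj)
  have abs_g: "\<bar>g y\<bar> = g y" for y by (simp add: g_def)
  \<comment> \<open>Invariance under \<open>S ^^ i\<close> places the target \<open>E i\<close> at
    time \<open>i\<close> and \<open>g\<close> at time \<open>j\<close>.\<close>
  have "(LINT y:E i|Y. g ((S ^^ (j - i)) y)) = (LINT y|Y. indicator (E i) y * g ((S ^^ (j - i)) y))"
    by (simp add: set_lebesgue_integral_def)
  also have "\<dots> = (LINT y|Y. indicator (E i) ((S ^^ i) y) * g ((S ^^ (j - i)) ((S ^^ i) y)))"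
    by (rule integral_funpow[symmetric]) measurable
  also have "\<dots> = expectation (\<lambda>y. X i y * (X j y * X k y * X l y))"
    using assms by (simp add: X_def gj[unfolded X_def] flip: funpow_add[unfolded o_def fun_eq_iff, rule_format])
  finally have lhs: "(LINT y:E i|Y. g ((S ^^ (j - i)) y)) = \<dots>" .
  have "integrable Y g"
    by (rule integrable_const_bound[where B = 1]) (auto simp: g_def indicator_def intro!: AE_I2)
  moreover have "AE y in Y. y \<notin> (\<Union>k\<in>{1..}. E k) \<longrightarrow> g y = 0"
    using assms by (intro AE_I2) (auto simp: g_def indicator_def)
  ultimately show ?thesis
    using decay[of i "j - i" g] assms by (simp add: lhs int_g abs_g \<sigma>)
qed

lemma decay_ZX:
  assumes "1 \<le> i" "i < j" "j \<le> k" "j \<le> l"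
  shows "\<bar>expectation (\<lambda>y. Z i y * (X j y * X k y * X l y))\<bar>
    \<le> C * \<rho> (j - i) * expectation (\<lambda>y. X j y * X k y * X l y)"
proof -
  have "expectation (\<lambda>y. Z i y * (X j y * X k y * X l y))
      = expectation (\<lambda>y. X i y * (X j y * X k y * X l y)) - \<sigma> i * expectation (\<lambda>y. X j y * X k y * X l y)"
    unfolding Z_def left_diff_distrib using integrable_X4 integrable_X3 by simp
  with decay_product[OF assms] show ?thesis by simp
qed

lemma X_idem: "X n y * X n y = X n y"
  using X_cases[of n y] by auto

lemma decay_pair:
  assumes "1 \<le> i" "i < j"
  shows "expectation (\<lambda>y. X i y * X j y) \<le> \<sigma> i * \<sigma> j + C * \<rho> (j - i) * \<sigma> j"
proof -
  have "\<bar>expectation (\<lambda>y. X i y * X j y) - \<sigma> i * \<sigma> j\<bar> \<le> C * \<rho> (j - i) * \<sigma> j"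
    using decay_product[OF assms, of j j] assms by (simp add: X_idem expectation_X)
  then show ?thesis by linarith
qed

text \<open>Expand \<open>Z\<^sub>j Z\<^sub>k Z\<^sub>l\<close> into products of the \<open>X\<close>'s: each nonempty product starts at a time
  \<open>\<ge> j\<close> and is supported in the targets, so decay applies to it, and the constant term
  contributes nothing because \<open>Z\<^sub>i\<close> has mean zero.\<close>

lemma decay_four:
  assumes "1 \<le> i" "i < j" "j \<le> k" "k \<le> l" "j < l"
  shows "\<bar>expectation (\<lambda>y. Z i y * Z j y * Z k y * Z l y)\<bar>
    \<le> C * \<rho> (j - i) * (7 * (\<sigma> j * \<sigma> l) + 2 * (C * \<rho> (l - j) * \<sigma> l))"
proof -
  define Q where "Q j k l = expectation (\<lambda>y. Z i y * (X j y * X k y * X l y))" for j k l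
  define e where "e j k l = expectation (\<lambda>y. X j y * X k y * X l y)" for j k l
  define B where "B = C * \<rho> (j - i)"
  have B0: "0 \<le> B" unfolding B_def using C \<rho>_nonneg[of "j - i"] assms by simp
  have e0: "0 \<le> e u v w" for u v w
    unfolding e_def by (rule Bochner_Integration.integral_nonneg) (simp add: X_bounds)
  \<comment> \<open>A product that starts at \<open>u \<ge> j\<close> decays with
    \<open>\<rho> (u - i)\<close>, at most \<open>\<rho> (j - i)\<close>; so \<open>B\<close> serves
    for all products.\<close>
  have Q: "\<bar>Q u v w\<bar> \<le> B * e u v w" if "j \<le> u" "u \<le> v" "u \<le> w" for u v w
  proof -
    have "\<bar>Q u v w\<bar> \<le> C * \<rho> (u - i) * e u v w"
      unfolding Q_def e_def by (rule decay_ZX) (use that assms in auto)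
    also have "\<dots> \<le> B * e u v w"
      unfolding B_def using C assms that e0
      by (intro mult_right_mono mult_left_mono \<rho>_dec) auto
    finally show ?thesis .
  qed
  have Z0: "expectation (Z i) = 0"
    unfolding Z_def using integrable_X expectation_X[OF assms(1)] by (simp add: prob_space)
  have intZ: "integrable Y (Z i)" unfolding Z_def using integrable_X by simp
  have int: "integrable Y (\<lambda>y. Z i y * (X u y * X v y * X w y))" for u v w
    by (rule integrable_ZX3[OF assms(1)])
  \<comment> \<open>Shorter products are padded to three factors by idempotence, so that every
    nonconstant term has the form covered by \<open>Q\<close>.\<close>
  have expand: "Z i y * Z j y * Z k y * Z l y =
      Z i y * (X j y * X k y * X l y) - \<sigma> l * (Z i y * (X j y * X k y * X k y))
      - \<sigma> k * (Z i y * (X j y * X l y * X l y)) - \<sigma> j * (Z i y * (X k y * X l y * X l y))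
      + \<sigma> k * \<sigma> l * (Z i y * (X j y * X j y * X j y)) + \<sigma> j * \<sigma> l * (Z i y * (X k y * X k y * X k y))
      + \<sigma> j * \<sigma> k * (Z i y * (X l y * X l y * X l y)) - \<sigma> j * \<sigma> k * \<sigma> l * Z i y" for y
    unfolding Z_def[of j] Z_def[of k] Z_def[of l] mult.assoc X_idem by (simp add: algebra_simps)
  have "expectation (\<lambda>y. Z i y * Z j y * Z k y * Z l y) =
      Q j k l - \<sigma> l * Q j k k - \<sigma> k * Q j l l - \<sigma> j * Q k l l
      + \<sigma> k * \<sigma> l * Q j j j + \<sigma> j * \<sigma> l * Q k k k + \<sigma> j * \<sigma> k * Q l l l"
    unfolding expand Q_def using int intZ Z0 by simp
  moreover have s: "0 < \<sigma> j" "0 < \<sigma> k" "0 < \<sigma> l" "\<sigma> j \<le> 1" "\<sigma> k \<le> 1" "\<sigma> l \<le> 1"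
    using assms by (auto intro!: \<sigma>_pos \<sigma>_le_1)
  define e2 where "e2 = expectation (\<lambda>y. X j y * X l y)"
  have e2_0: "0 \<le> e2"
    unfolding e2_def by (rule Bochner_Integration.integral_nonneg) (simp add: X_bounds)
  have single: "e u u u = \<sigma> u" if "j \<le> u" for u
    unfolding e_def X_idem using that assms by (simp add: expectation_X)
  have ejkl: "e j k l \<le> e2"
    unfolding e_def e2_def
    by (rule integral_mono[OF integrable_X3 integrable_X2]) (auto simp: X_def indicator_def)
  have ejll: "e j l l = e2" by (simp add: e_def e2_def mult.assoc X_idem)
  have ejkk: "e j k k \<le> \<sigma> j"
  proof -
    have "e j k k \<le> e j j j"
      unfolding e_def by (rule integral_mono[OF integrable_X3 integrable_X3]) (auto simp: X_def indicator_def)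
    then show ?thesis by (simp add: single)
  qed
  have ekll: "e k l l \<le> \<sigma> l"
  proof -
    have "e k l l \<le> e l l l"
      unfolding e_def by (rule integral_mono[OF integrable_X3 integrable_X3]) (auto simp: X_def indicator_def)
    then show ?thesis using assms by (simp add: single)
  qed
  define t where "t = \<sigma> j * \<sigma> l"
  have ineq: "\<bar>c * Q u v w\<bar> \<le> B * b"
    if "j \<le> u" "u \<le> v" "u \<le> w" "0 \<le> c" "c * e u v w \<le> b" for c u v w b
  proof -
    have "\<bar>c * Q u v w\<bar> = c * \<bar>Q u v w\<bar>" using that by (simp add: abs_mult)
    also have "\<dots> \<le> c * (B * e u v w)" using Q[of u v w] that by (intro mult_left_mono) auto
    also have "\<dots> = B * (c * e u v w)" by simp
    also have "\<dots> \<le> B * b" using that B0 by (intro mult_left_mono) auto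
    finally show ?thesis .
  qed
  have t3: "\<sigma> j * \<sigma> k * \<sigma> l \<le> t"
    using s mult_left_mono[of "\<sigma> k" 1 "\<sigma> j * \<sigma> l"] by (simp add: t_def mult_ac)
  have "\<bar>Q j k l\<bar> \<le> B * e2" using ineq[of j k l 1 e2] ejkl assms by simp
  moreover have "\<bar>\<sigma> l * Q j k k\<bar> \<le> B * t"
    by (rule ineq) (use s assms mult_left_mono[OF ejkk, of "\<sigma> l"] in \<open>auto simp: t_def mult_ac\<close>)
  moreover have "\<bar>\<sigma> k * Q j l l\<bar> \<le> B * e2"
    by (rule ineq) (use s assms mult_right_mono[of "\<sigma> k" 1 e2] e2_0 in \<open>auto simp: ejll\<close>)
  moreover have "\<bar>\<sigma> j * Q k l l\<bar> \<le> B * t"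
    by (rule ineq) (use s assms mult_left_mono[OF ekll, of "\<sigma> j"] in \<open>auto simp: t_def mult_ac\<close>)
  moreover have "\<bar>\<sigma> k * \<sigma> l * Q j j j\<bar> \<le> B * t"
    by (rule ineq) (use s assms t3 in \<open>auto simp: single mult_ac\<close>)
  moreover have "\<bar>\<sigma> j * \<sigma> l * Q k k k\<bar> \<le> B * t"
    by (rule ineq) (use s assms t3 in \<open>auto simp: single mult_ac\<close>)
  moreover have "\<bar>\<sigma> j * \<sigma> k * Q l l l\<bar> \<le> B * t"
    by (rule ineq) (use s assms t3 in \<open>auto simp: single mult_ac\<close>)
  \<comment> \<open>Five of the seven terms cost \<open>t\<close> and two cost \<open>e2\<close>.
    The pair estimate \<open>e2 \<le> t + C * \<rho> (l - j) * \<sigma> l\<close> then turns the 5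
    into 7.\<close>
  ultimately have "\<bar>expectation (\<lambda>y. Z i y * Z j y * Z k y * Z l y)\<bar> \<le> 5 * (B * t) + 2 * (B * e2)"
    by linarith
  also have "\<dots> = B * (5 * t + 2 * e2)" by (simp add: algebra_simps)
  also have "\<dots> \<le> B * (7 * t + 2 * (C * \<rho> (l - j) * \<sigma> l))"
  proof (rule mult_left_mono[OF _ B0])
    have "e2 \<le> t + C * \<rho> (l - j) * \<sigma> l"
      unfolding e2_def t_def by (rule decay_pair) (use assms in auto)
    then show "5 * t + 2 * e2 \<le> 7 * t + 2 * (C * \<rho> (l - j) * \<sigma> l)" by linarith
  qed
  finally show ?thesis by (simp add: B_def t_def)
qed

text \<open>The smaller of \<open>m\<close> and \<open>h\<close> is the first gap among the four
  times, and the larger is the distance from the second time to the last. If they agree, the two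
  middle times coincide, which \<open>decay_four\<close> permits.\<close>

lemma offdiagonal_bound:
  assumes "1 \<le> n" "1 \<le> m" "1 \<le> h"
  shows "expectation (\<lambda>y. (Z n y * Z (n + m) y) * (Z (n + h) y * Z (n + h + m) y))
    \<le> C * (7 * \<sigma> n * (\<rho> m * \<sigma> h + \<rho> h * \<sigma> m) + 2 * C * \<rho> m * \<rho> h * \<sigma> n)"
proof -
  have *: "expectation (\<lambda>y. Z n y * Z (n + p) y * Z (n + q) y * Z (n + q + p) y)
      \<le> C * (7 * \<sigma> n * (\<rho> p * \<sigma> q + \<rho> q * \<sigma> p) + 2 * C * \<rho> p * \<rho> q * \<sigma> n)"
    if "1 \<le> p" "p \<le> q" for p q
  proof -
    have nn: "0 \<le> \<rho> p" "0 \<le> \<rho> q" "0 < \<sigma> n" "0 < \<sigma> p" "0 < \<sigma> q"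
      using that assms by (auto intro!: \<rho>_nonneg \<sigma>_pos)
    have s: "\<sigma> (n + p) \<le> \<sigma> n" "\<sigma> (n + q + p) \<le> \<sigma> q" "\<sigma> (n + q + p) \<le> \<sigma> n" "0 < \<sigma> (n + q + p)"
      using that assms by (auto intro!: \<sigma>_dec \<sigma>_pos)
    have "\<bar>expectation (\<lambda>y. Z n y * Z (n + p) y * Z (n + q) y * Z (n + q + p) y)\<bar>
        \<le> C * \<rho> (n + p - n) * (7 * (\<sigma> (n + p) * \<sigma> (n + q + p))
          + 2 * (C * \<rho> (n + q + p - (n + p)) * \<sigma> (n + q + p)))"
      by (rule decay_four) (use that assms in auto)
    also have "\<dots> = C * \<rho> p * (7 * (\<sigma> (n + p) * \<sigma> (n + q + p)) + 2 * (C * \<rho> q * \<sigma> (n + q + p)))"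
      by simp
    also have "\<dots> \<le> C * \<rho> p * (7 * (\<sigma> n * \<sigma> q) + 2 * (C * \<rho> q * \<sigma> n))"
      using nn s C by (intro mult_left_mono add_mono mult_mono) auto
    \<comment> \<open>A nonnegative term is added to make the bound symmetric in \<open>p\<close>
      and \<open>q\<close>, so that both orders of \<open>m\<close> and \<open>h\<close> give the
      same bound.\<close>
    also have "\<dots> \<le> C * \<rho> p * (7 * (\<sigma> n * \<sigma> q) + 2 * (C * \<rho> q * \<sigma> n)) + C * (7 * \<sigma> n * (\<rho> q * \<sigma> p))"
      using nn C by simp
    also have "\<dots> = C * (7 * \<sigma> n * (\<rho> p * \<sigma> q + \<rho> q * \<sigma> p) + 2 * C * \<rho> p * \<rho> q * \<sigma> n)"
      by (simp add: algebra_simps)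
    finally show ?thesis by linarith
  qed
  show ?thesis
  proof (cases "m \<le> h")
    case True
    with *[of m h] assms show ?thesis by (simp add: mult.assoc)
  next
    case False
    with *[of h m] assms show ?thesis by (simp add: mult_ac add_ac)
  qed
qed

section \<open>Second moments of the correlations\<close>

text \<open>Pointwise \<open>(Z k y)\<^sup>2\<close> is at most
  \<open>X k y + (\<sigma> k)\<^sup>2\<close>, which leaves only the pair estimate for the product
  of two hits.\<close>

lemma diagonal_bound:
  assumes "1 \<le> n" "1 \<le> m"
  shows "expectation (\<lambda>y. (Z n y * Z (n + m) y)\<^sup>2) \<le> 4 * (\<sigma> n * \<sigma> m) + C * \<rho> m * \<sigma> n"
proof -
  let ?s = "\<sigma> n" and ?s' = "\<sigma> (n + m)"
  have s: "0 < ?s" "?s \<le> 1" "0 < ?s'" "?s' \<le> 1" "?s' \<le> \<sigma> m" "?s' \<le> ?s"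
    using assms by (auto intro!: \<sigma>_pos \<sigma>_le_1 \<sigma>_dec)
  have Z2: "(Z k y)\<^sup>2 \<le> X k y + (\<sigma> k)\<^sup>2" if "1 \<le> k" for k y
    using X_cases[of k y] \<sigma>_pos[OF that] by (auto simp: Z_def power2_eq_square algebra_simps)
  have "expectation (\<lambda>y. (Z n y * Z (n + m) y)\<^sup>2)
      \<le> expectation (\<lambda>y. X n y * X (n + m) y + ?s'\<^sup>2 * X n y + ?s\<^sup>2 * X (n + m) y + ?s\<^sup>2 * ?s'\<^sup>2)"
  proof (rule integral_mono)
    show "integrable Y (\<lambda>y. (Z n y * Z (n + m) y)\<^sup>2)"
    proof (rule integrable_const_bound[where B = 1])
      have "\<bar>Z n y * Z (n + m) y\<bar> \<le> 1" for y
        using assms by (simp add: abs_mult mult_le_one Z_le)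
      then show "AE y in Y. norm ((Z n y * Z (n + m) y)\<^sup>2) \<le> 1"
        by (simp add: abs_square_le_1)
    qed simp
    show "integrable Y (\<lambda>y. X n y * X (n + m) y + ?s'\<^sup>2 * X n y + ?s\<^sup>2 * X (n + m) y + ?s\<^sup>2 * ?s'\<^sup>2)"
      using integrable_X2 integrable_X by simp
    fix y
    have "(Z n y * Z (n + m) y)\<^sup>2 \<le> (X n y + ?s\<^sup>2) * (X (n + m) y + ?s'\<^sup>2)"
      unfolding power_mult_distrib using assms by (intro mult_mono Z2 add_nonneg_nonneg X_bounds) auto
    then show "(Z n y * Z (n + m) y)\<^sup>2 \<le> X n y * X (n + m) y + ?s'\<^sup>2 * X n y + ?s\<^sup>2 * X (n + m) y + ?s\<^sup>2 * ?s'\<^sup>2"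
      by (simp add: algebra_simps)
  qed
  also have "\<dots> = expectation (\<lambda>y. X n y * X (n + m) y) + ?s'\<^sup>2 * ?s + ?s\<^sup>2 * ?s' + ?s\<^sup>2 * ?s'\<^sup>2"
    using integrable_X2 integrable_X assms by (simp add: expectation_X prob_space)
  \<comment> \<open>One product of the two measures comes from the pair estimate and one from each
    of the other three terms, whence the factor 4.\<close>
  also have "\<dots> \<le> (?s * ?s' + C * \<rho> m * ?s') + ?s * ?s' + ?s * ?s' + ?s * ?s'"
  proof (intro add_mono)
    show "expectation (\<lambda>y. X n y * X (n + m) y) \<le> ?s * ?s' + C * \<rho> m * ?s'"
      using decay_pair[of n "n + m"] assms by simp
    have "?s\<^sup>2 \<le> ?s" "?s'\<^sup>2 \<le> ?s'"
      using s mult_left_mono[of ?s 1 ?s] mult_left_mono[of ?s' 1 ?s'] by (simp_all add: power2_eq_square)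
    then show "?s'\<^sup>2 * ?s \<le> ?s * ?s'" "?s\<^sup>2 * ?s' \<le> ?s * ?s'" "?s\<^sup>2 * ?s'\<^sup>2 \<le> ?s * ?s'"
      using s by (auto intro: mult_mono simp: mult.commute)
  qed
  also have "\<dots> = 4 * (?s * ?s') + C * \<rho> m * ?s'" by simp
  also have "\<dots> \<le> 4 * (?s * \<sigma> m) + C * \<rho> m * ?s"
    using s C \<rho>_nonneg[of m] assms by (intro add_mono mult_left_mono) auto
  finally show ?thesis .
qed

definition W :: "nat \<Rightarrow> real" where
  "W N = (\<Sum>n=1..N. \<sigma> n)"

lemma R_nonneg: "0 \<le> R"
  using \<rho>_sum[of 0] by simp

text \<open>The square is expanded by a second gap \<open>h\<close>. All term bounds are
  nonnegative, so the ranges may be enlarged to \<open>{1..N}\<close>, where the sums factor into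
  \<open>W N\<close> and partial sums of \<open>\<rho>\<close>. The result is linear in
  \<open>\<sigma> m\<close> and \<open>\<rho> m\<close>, ready to be summed over
  \<open>m\<close>.\<close>

lemma correlation_second_moment:
  assumes "1 \<le> m"
  shows "expectation (\<lambda>y. (\<Sum>n=1..N-m. Z n y * Z (n + m) y)\<^sup>2)
    \<le> (4 + 14 * C * R) * W N * \<sigma> m + (C * W N + 14 * C * (W N)\<^sup>2 + 4 * C\<^sup>2 * R * W N) * \<rho> m"
proof -
  let ?a = "\<lambda>n y. Z n y * Z (n + m) y"
  have int: "integrable Y (\<lambda>y. ?a n y * ?a k y)" if "1 \<le> n" "1 \<le> k" for n k
    by (rule integrable_const_bound[where B = 1])
       (use that in \<open>auto intro!: AE_I2 simp: abs_mult mult_le_one Z_le\<close>)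
  have nn: "0 \<le> \<sigma> n" "0 \<le> \<rho> n" if "n \<in> {1..N}" for n
    using that \<sigma>_pos[of n] \<rho>_nonneg[of n] by auto
  have m: "0 < \<sigma> m" "0 \<le> \<rho> m" using assms by (auto intro!: \<sigma>_pos \<rho>_nonneg)
  have W0: "0 \<le> W N" unfolding W_def by (intro sum_nonneg nn)
  have "expectation (\<lambda>y. (\<Sum>n=1..N-m. ?a n y)\<^sup>2)
      = (\<Sum>n=1..N-m. expectation (\<lambda>y. (?a n y)\<^sup>2))
      + 2 * (\<Sum>h=1..N-m. \<Sum>n=1..N-m-h. expectation (\<lambda>y. ?a n y * ?a (n + h) y))"
  proof -
    have i1: "integrable Y (\<lambda>y. (?a n y)\<^sup>2)" if "n \<in> {1..N-m}" for n
      using int[of n n] that by (simp add: power2_eq_square)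
    have i2: "integrable Y (\<lambda>y. ?a n y * ?a (n + h) y)" if "n \<in> {1..N-m-h}" for n h
      using int[of n "n + h"] that by simp
    have i3: "integrable Y (\<lambda>y. \<Sum>n=1..N-m-h. ?a n y * ?a (n + h) y)" for h
      by (rule Bochner_Integration.integrable_sum) (rule i2)
    have "expectation (\<lambda>y. (\<Sum>n=1..N-m. ?a n y)\<^sup>2) = expectation (\<lambda>y. \<Sum>n=1..N-m. (?a n y)\<^sup>2)
        + expectation (\<lambda>y. 2 * (\<Sum>h=1..N-m. \<Sum>n=1..N-m-h. ?a n y * ?a (n + h) y))"
      unfolding square_sum_correlations
      by (intro Bochner_Integration.integral_add integrable_mult_right Bochner_Integration.integrable_sum i1 i3)
    also have "expectation (\<lambda>y. \<Sum>n=1..N-m. (?a n y)\<^sup>2) = (\<Sum>n=1..N-m. expectation (\<lambda>y. (?a n y)\<^sup>2))"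
      by (rule Bochner_Integration.integral_sum) (rule i1)
    also have "expectation (\<lambda>y. 2 * (\<Sum>h=1..N-m. \<Sum>n=1..N-m-h. ?a n y * ?a (n + h) y))
        = 2 * (\<Sum>h=1..N-m. expectation (\<lambda>y. \<Sum>n=1..N-m-h. ?a n y * ?a (n + h) y))"
      by (subst integral_mult_right_zero, subst Bochner_Integration.integral_sum[OF i3]) simp
    also have "(\<Sum>h=1..N-m. expectation (\<lambda>y. \<Sum>n=1..N-m-h. ?a n y * ?a (n + h) y))
        = (\<Sum>h=1..N-m. \<Sum>n=1..N-m-h. expectation (\<lambda>y. ?a n y * ?a (n + h) y))"
      by (intro sum.cong refl Bochner_Integration.integral_sum i2)
    finally show ?thesis .
  qed
  also have "\<dots> \<le> (\<Sum>n=1..N. 4 * (\<sigma> n * \<sigma> m) + C * \<rho> m * \<sigma> n)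
      + 2 * (\<Sum>h=1..N. \<Sum>n=1..N. C * (7 * \<sigma> n * (\<rho> m * \<sigma> h + \<rho> h * \<sigma> m) + 2 * C * \<rho> m * \<rho> h * \<sigma> n))"
  proof (intro add_mono mult_left_mono)
    have "(\<Sum>n=1..N-m. expectation (\<lambda>y. (?a n y)\<^sup>2)) \<le> (\<Sum>n=1..N-m. 4 * (\<sigma> n * \<sigma> m) + C * \<rho> m * \<sigma> n)"
      using assms by (intro sum_mono diagonal_bound) auto
    also have "\<dots> \<le> (\<Sum>n=1..N. 4 * (\<sigma> n * \<sigma> m) + C * \<rho> m * \<sigma> n)"
      using C m nn by (intro sum_mono2) auto
    finally show "(\<Sum>n=1..N-m. expectation (\<lambda>y. (?a n y)\<^sup>2)) \<le> \<dots>" .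
    let ?b = "\<lambda>n h. C * (7 * \<sigma> n * (\<rho> m * \<sigma> h + \<rho> h * \<sigma> m) + 2 * C * \<rho> m * \<rho> h * \<sigma> n)"
    have b0: "0 \<le> ?b n h" if "n \<in> {1..N}" "h \<in> {1..N}" for n h
      using C m nn[OF that(1)] nn[OF that(2)] by simp
    have "(\<Sum>h=1..N-m. \<Sum>n=1..N-m-h. expectation (\<lambda>y. ?a n y * ?a (n + h) y))
        \<le> (\<Sum>h=1..N-m. \<Sum>n=1..N-m-h. ?b n h)"
      using assms by (intro sum_mono offdiagonal_bound) auto
    also have "\<dots> \<le> (\<Sum>h=1..N-m. \<Sum>n=1..N. ?b n h)"
      by (intro sum_mono sum_mono2) (auto intro!: b0)
    also have "\<dots> \<le> (\<Sum>h=1..N. \<Sum>n=1..N. ?b n h)"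
      by (intro sum_mono2 sum_nonneg) (auto intro!: b0)
    finally show "(\<Sum>h=1..N-m. \<Sum>n=1..N-m-h. expectation (\<lambda>y. ?a n y * ?a (n + h) y))
        \<le> (\<Sum>h=1..N. \<Sum>n=1..N. ?b n h)" .
  qed simp
  also have "(\<Sum>h=1..N. \<Sum>n=1..N. C * (7 * \<sigma> n * (\<rho> m * \<sigma> h + \<rho> h * \<sigma> m) + 2 * C * \<rho> m * \<rho> h * \<sigma> n))
      = (\<Sum>h=1..N. C * (7 * W N * (\<rho> m * \<sigma> h + \<rho> h * \<sigma> m) + 2 * C * \<rho> m * \<rho> h * W N))"
    unfolding W_def by (simp add: sum.distrib sum_distrib_left sum_distrib_right algebra_simps)
  also have "\<dots> = C * (7 * W N * (\<rho> m * W N + (\<Sum>h=1..N. \<rho> h) * \<sigma> m) + 2 * C * \<rho> m * (\<Sum>h=1..N. \<rho> h) * W N)"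
  proof -
    have "(\<Sum>h=1..N. C * (7 * w * (\<rho> m * \<sigma> h + \<rho> h * \<sigma> m) + 2 * C * \<rho> m * \<rho> h * w))
        = C * (7 * w * (\<rho> m * (\<Sum>h=1..N. \<sigma> h) + (\<Sum>h=1..N. \<rho> h) * \<sigma> m) + 2 * C * \<rho> m * (\<Sum>h=1..N. \<rho> h) * w)" for w
      by (simp add: sum.distrib sum_distrib_left sum_distrib_right algebra_simps)
    then show ?thesis by (simp only: W_def)
  qed
  also have "\<dots> \<le> C * (7 * W N * (\<rho> m * W N + R * \<sigma> m) + 2 * C * \<rho> m * R * W N)"
    using C W0 m \<rho>_sum[of N] by (intro mult_left_mono add_mono mult_right_mono) auto
  also have "(\<Sum>n=1..N. 4 * (\<sigma> n * \<sigma> m) + C * \<rho> m * \<sigma> n) = 4 * W N * \<sigma> m + C * \<rho> m * W N"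
    unfolding W_def by (simp add: sum.distrib sum_distrib_left sum_distrib_right algebra_simps)
  finally show ?thesis by (simp add: algebra_simps power2_eq_square)
qed

text \<open>Summing the second moments over \<open>m\<close> gives \<open>4 + 28 * C * R\<close>
  times \<open>(W N)\<^sup>2\<close> plus a term linear in \<open>W N\<close>; the latter is made
  quadratic by \<open>W N / \<sigma> 1 \<ge> 1\<close>.\<close>

definition K :: real where
  "K = 4 + 28 * C * R + (C * R + 4 * C\<^sup>2 * R\<^sup>2) / \<sigma> 1"

lemma K_nonneg: "0 \<le> K"
  using C R_nonneg \<sigma>_pos[of 1] by (simp add: K_def)

lemma sum_second_moments:
  assumes "1 \<le> N"
  shows "(\<Sum>m=1..N. expectation (\<lambda>y. (\<Sum>n=1..N-m. Z n y * Z (n + m) y)\<^sup>2)) \<le> K * (W N)\<^sup>2"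
proof -
  have "\<sigma> 1 \<le> W N"
    unfolding W_def using assms less_imp_le[OF \<sigma>_pos] by (intro member_le_sum) auto
  then have W: "0 < W N" "1 \<le> W N / \<sigma> 1" using \<sigma>_pos[of 1] by auto
  have "(\<Sum>m=1..N. expectation (\<lambda>y. (\<Sum>n=1..N-m. Z n y * Z (n + m) y)\<^sup>2))
    \<le> (\<Sum>m=1..N. (4 + 14 * C * R) * W N * \<sigma> m + (C * W N + 14 * C * (W N)\<^sup>2 + 4 * C\<^sup>2 * R * W N) * \<rho> m)"
    by (intro sum_mono correlation_second_moment) auto
  also have "\<dots> = (4 + 14 * C * R) * W N * W N
      + (C * W N + 14 * C * (W N)\<^sup>2 + 4 * C\<^sup>2 * R * W N) * (\<Sum>m=1..N. \<rho> m)"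
    unfolding sum.distrib W_def[of N] sum_distrib_left by simp
  also have "\<dots> \<le> (4 + 14 * C * R) * W N * W N + (C * W N + 14 * C * (W N)\<^sup>2 + 4 * C\<^sup>2 * R * W N) * R"
    using C R_nonneg W \<rho>_sum[of N] by (intro add_mono mult_left_mono) auto
  also have "\<dots> = (4 + 28 * C * R) * (W N)\<^sup>2 + (C * R + 4 * C\<^sup>2 * R\<^sup>2) * (W N * 1)"
    by (simp add: algebra_simps power2_eq_square)
  also have "\<dots> \<le> (4 + 28 * C * R) * (W N)\<^sup>2 + (C * R + 4 * C\<^sup>2 * R\<^sup>2) * (W N * (W N / \<sigma> 1))"
    using C R_nonneg W by (intro add_mono mult_left_mono) auto
  also have "\<dots> = K * (W N)\<^sup>2"
    by (simp add: K_def power2_eq_square algebra_simps add_divide_distrib)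
  finally show ?thesis .
qed

section \<open>Summability of the correlations at almost every point\<close>

lemma integrable_correlation_sum: "integrable Y (\<lambda>y. correlation_sum (\<lambda>n. Z n y) N)"
proof -
  have int: "integrable Y (\<lambda>y. Z n y * Z k y)" if "1 \<le> n" "1 \<le> k" for n k
    by (rule integrable_const_bound[where B = 1])
       (use that in \<open>auto intro!: AE_I2 simp: abs_mult mult_le_one Z_le\<close>)
  show ?thesis
    unfolding correlation_sum_def power2_eq_square
    by (intro Bochner_Integration.integrable_add Bochner_Integration.integrable_sum
        integrable_mult_right integrable_abs int) auto
qed

text \<open>The \<open>N\<close> correlations have second moments of total at most
  \<open>K * (W N)\<^sup>2\<close>, so their first moments total at most a constant times
  \<open>sqrt N * W N\<close>. In \<open>K + 3\<close>, the two halves of the quadratic inequality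
  contribute \<open>K\<close> and 1, and the diagonal contributes 2.\<close>

lemma expectation_correlation_sum:
  assumes "1 \<le> N"
  shows "expectation (\<lambda>y. correlation_sum (\<lambda>n. Z n y) N) / (W N)\<^sup>2 \<le> (K + 3) * sqrt N / W N"
proof -
  let ?P = "\<lambda>m y. \<Sum>n=1..N-m. Z n y * Z (n + m) y"
  have int: "integrable Y (\<lambda>y. Z n y * Z k y)" if "1 \<le> n" "1 \<le> k" for n k
    by (rule integrable_const_bound[where B = 1])
       (use that in \<open>auto intro!: AE_I2 simp: abs_mult mult_le_one Z_le\<close>)
  have intP: "integrable Y (?P m)" for m
    by (intro Bochner_Integration.integrable_sum int) auto
  have intP2: "integrable Y (\<lambda>y. (?P m y)\<^sup>2)" for m
  proof (rule integrable_const_bound[where B = "(real N)\<^sup>2"])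
    show "AE y in Y. norm ((?P m y)\<^sup>2) \<le> (real N)\<^sup>2"
    proof (rule AE_I2)
      fix y
      have "\<bar>?P m y\<bar> \<le> (\<Sum>n=1..N-m. \<bar>Z n y * Z (n + m) y\<bar>)" by (rule sum_abs)
      also have "\<dots> \<le> (\<Sum>n=1..N-m. 1)"
        by (intro sum_mono) (auto simp: abs_mult mult_le_one Z_le)
      also have "\<dots> \<le> \<bar>real N\<bar>" by simp
      finally have "(?P m y)\<^sup>2 \<le> (real N)\<^sup>2" by (simp only: abs_le_square_iff)
      then show "norm ((?P m y)\<^sup>2) \<le> (real N)\<^sup>2" by simp
    qed
  qed simp
  have W: "0 < W N" unfolding W_def using assms by (intro sum_pos \<sigma>_pos) auto
  \<comment> \<open>balances the two terms in \<open>2 \<bar>x\<bar> \<le> t x\<^sup>2 + 1 / t\<close>, summed over \<open>m \<le> N\<close>\<close>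
  define t where "t = sqrt N / W N"
  have t: "0 < t" using W assms by (simp add: t_def)
  have Z2: "expectation (\<lambda>y. (Z n y)\<^sup>2) \<le> 2 * \<sigma> n" if "1 \<le> n" for n
  proof -
    have "expectation (\<lambda>y. (Z n y)\<^sup>2) \<le> expectation (\<lambda>y. X n y + \<sigma> n)"
    proof (rule integral_mono)
      show "integrable Y (\<lambda>y. (Z n y)\<^sup>2)" using int[OF that that] by (simp add: power2_eq_square)
      show "integrable Y (\<lambda>y. X n y + \<sigma> n)" using integrable_X by simp
      fix y
      have "\<sigma> n * \<sigma> n \<le> \<sigma> n" using mult_left_mono[of "\<sigma> n" 1 "\<sigma> n"] \<sigma>_le_1 \<sigma>_pos that by simp
      then show "(Z n y)\<^sup>2 \<le> X n y + \<sigma> n"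
        using X_cases[of n y] \<sigma>_pos[OF that] by (auto simp: Z_def power2_eq_square algebra_simps)
    qed
    also have "\<dots> = 2 * \<sigma> n" using integrable_X that by (simp add: expectation_X prob_space)
    finally show ?thesis .
  qed
  have "expectation (\<lambda>y. correlation_sum (\<lambda>n. Z n y) N)
      \<le> expectation (\<lambda>y. (\<Sum>n=1..N. (Z n y)\<^sup>2) + (\<Sum>m=1..N. t * (?P m y)\<^sup>2 + 1 / t))"
  proof (rule integral_mono[OF integrable_correlation_sum])
    show "integrable Y (\<lambda>y. (\<Sum>n=1..N. (Z n y)\<^sup>2) + (\<Sum>m=1..N. t * (?P m y)\<^sup>2 + 1 / t))"
      using int by (intro Bochner_Integration.integrable_add Bochner_Integration.integrable_sum
          integrable_mult_right intP2 integrable_const) (auto simp: power2_eq_square)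
    fix y
    have am: "2 * \<bar>x\<bar> \<le> t * x\<^sup>2 + 1 / t" for x :: real
    proof -
      have "0 \<le> (t * \<bar>x\<bar> - 1)\<^sup>2 / t" using t by simp
      also have "\<dots> = t * x\<^sup>2 + 1 / t - 2 * \<bar>x\<bar>"
        using t by (simp add: power2_eq_square field_simps)
      finally show ?thesis by simp
    qed
    show "correlation_sum (\<lambda>n. Z n y) N \<le> (\<Sum>n=1..N. (Z n y)\<^sup>2) + (\<Sum>m=1..N. t * (?P m y)\<^sup>2 + 1 / t)"
      unfolding correlation_sum_def sum_distrib_left by (intro add_left_mono sum_mono am)
  qed
  also have "\<dots> = (\<Sum>n=1..N. expectation (\<lambda>y. (Z n y)\<^sup>2))
      + (\<Sum>m=1..N. t * expectation (\<lambda>y. (?P m y)\<^sup>2) + 1 / t)"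
  proof -
    have i1: "integrable Y (\<lambda>y. (Z n y)\<^sup>2)" if "n \<in> {1..N}" for n
      using int[of n n] that by (simp add: power2_eq_square)
    have i2: "integrable Y (\<lambda>y. t * (?P m y)\<^sup>2 + 1 / t)" for m
      using intP2[of m] by simp
    have "expectation (\<lambda>y. (\<Sum>n=1..N. (Z n y)\<^sup>2) + (\<Sum>m=1..N. t * (?P m y)\<^sup>2 + 1 / t))
        = expectation (\<lambda>y. \<Sum>n=1..N. (Z n y)\<^sup>2) + expectation (\<lambda>y. \<Sum>m=1..N. t * (?P m y)\<^sup>2 + 1 / t)"
      by (intro Bochner_Integration.integral_add Bochner_Integration.integrable_sum i1 i2)
    also have "expectation (\<lambda>y. \<Sum>n=1..N. (Z n y)\<^sup>2) = (\<Sum>n=1..N. expectation (\<lambda>y. (Z n y)\<^sup>2))"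
      by (rule Bochner_Integration.integral_sum) (rule i1)
    also have "expectation (\<lambda>y. \<Sum>m=1..N. t * (?P m y)\<^sup>2 + 1 / t)
        = (\<Sum>m=1..N. expectation (\<lambda>y. t * (?P m y)\<^sup>2 + 1 / t))"
      by (rule Bochner_Integration.integral_sum) (rule i2)
    also have "\<dots> = (\<Sum>m=1..N. t * expectation (\<lambda>y. (?P m y)\<^sup>2) + 1 / t)"
      using intP2 by (intro sum.cong refl) (simp add: prob_space)
    finally show ?thesis .
  qed
  also have "\<dots> \<le> (\<Sum>n=1..N. 2 * \<sigma> n) + (t * (K * (W N)\<^sup>2) + real N / t)"
  proof (intro add_mono sum_mono Z2)
    have "(\<Sum>m=1..N. t * expectation (\<lambda>y. (?P m y)\<^sup>2) + 1 / t)
        = t * (\<Sum>m=1..N. expectation (\<lambda>y. (?P m y)\<^sup>2)) + real N / t"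
      by (simp add: sum.distrib sum_distrib_left)
    also have "\<dots> \<le> t * (K * (W N)\<^sup>2) + real N / t"
      using t by (intro add_mono mult_left_mono sum_second_moments[OF assms]) auto
    finally show "(\<Sum>m=1..N. t * expectation (\<lambda>y. (?P m y)\<^sup>2) + 1 / t) \<le> \<dots>" .
  qed auto
  also have "\<dots> = 2 * W N * 1 + (K + 1) * sqrt N * W N"
  proof -
    have "real N / t = sqrt N * W N"
    proof -
      have "0 < sqrt N" using assms by simp
      then have "sqrt N * sqrt N / t = sqrt N * W N" by (simp add: t_def del: real_sqrt_mult_self)
      then show ?thesis by simp
    qed
    moreover have "t * (K * (W N)\<^sup>2) = K * sqrt N * W N"
      using W by (simp add: t_def power2_eq_square)
    ultimately show ?thesis by (simp add: W_def sum_distrib_left algebra_simps)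
  qed
  also have "\<dots> \<le> 2 * W N * sqrt N + (K + 1) * sqrt N * W N"
    using W assms by (intro add_right_mono mult_left_mono) auto
  finally have "expectation (\<lambda>y. correlation_sum (\<lambda>n. Z n y) N) \<le> (K + 3) * sqrt N * W N"
    by (simp add: algebra_simps)
  then have "expectation (\<lambda>y. correlation_sum (\<lambda>n. Z n y) N) / (W N)\<^sup>2 \<le> (K + 3) * sqrt N * W N / (W N)\<^sup>2"
    by (rule divide_right_mono) simp
  then show ?thesis using W by (simp add: power2_eq_square)
qed

text \<open>At \<open>N = k ^ p\<close> the expectation is at most a constant times
  \<open>N powr (a - 1 / 2)\<close>, and \<open>p\<close> is large enough to make this at most
  \<open>k powr - 2\<close>.\<close>

lemma AE_summable_correlations:
  assumes W_ge: "\<And>N. 1 \<le> N \<Longrightarrow> c * real N powr (1 - a) \<le> W N" and "0 < c"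
    and "1 \<le> p" and p: "2 \<le> real p * (1 / 2 - a)"
  shows "AE y in Y. summable (\<lambda>k. correlation_sum (\<lambda>n. Z n y) (k ^ p) / (W (k ^ p))\<^sup>2)"
proof (rule AE_summable_integrals)
  show "integrable Y (\<lambda>y. correlation_sum (\<lambda>n. Z n y) (k ^ p) / (W (k ^ p))\<^sup>2)" for k
    using integrable_correlation_sum by simp
  show "0 \<le> correlation_sum (\<lambda>n. Z n y) (k ^ p) / (W (k ^ p))\<^sup>2" for k y
    using correlation_sum_nonneg by simp
  show "summable (\<lambda>k. (K + 3) / c * real k powr - 2)"
    by (intro summable_mult) (simp add: summable_real_powr_iff)
  show "expectation (\<lambda>y. correlation_sum (\<lambda>n. Z n y) (k ^ p) / (W (k ^ p))\<^sup>2)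
      \<le> (K + 3) / c * real k powr - 2" for k
  \<comment> \<open>At \<open>k = 0\<close> both sides vanish: the correlation sum is empty, and
    \<open>0 powr - 2\<close> is 0.\<close>
  proof (cases "k = 0")
    case True
    then show ?thesis using \<open>1 \<le> p\<close> by (simp add: power_0_left correlation_sum_def)
  next
    case False
    define N where "N = k ^ p"
    have N: "1 \<le> N" using False by (simp add: N_def)
    have NK: "real N = real k powr real p" using False by (simp add: N_def powr_realpow)
    have pos: "0 < c * real N powr (1 - a)" using \<open>0 < c\<close> N by simp
    have "expectation (\<lambda>y. correlation_sum (\<lambda>n. Z n y) N / (W N)\<^sup>2)
        = expectation (\<lambda>y. correlation_sum (\<lambda>n. Z n y) N) / (W N)\<^sup>2" by simp
    also have "\<dots> \<le> (K + 3) * sqrt N / W N" by (rule expectation_correlation_sum[OF N])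
    also have "\<dots> \<le> (K + 3) * sqrt N / (c * real N powr (1 - a))"
      using pos W_ge[OF N] K_nonneg less_le_trans[OF pos W_ge[OF N]] by (intro divide_left_mono mult_pos_pos[of _ "c * real N powr (1 - a)"]) auto
    also have "\<dots> = (K + 3) / c * (real N powr (1 / 2) / real N powr (1 - a))"
      by (simp add: powr_half_sqrt)
    also have "real N powr (1 / 2) / real N powr (1 - a) = real N powr (a - 1 / 2)"
      by (simp add: powr_diff[symmetric])
    also have "\<dots> = real k powr (real p * (a - 1 / 2))" by (simp add: NK powr_powr)
    also have "(K + 3) / c * \<dots> \<le> (K + 3) / c * real k powr - 2"
      using p False K_nonneg \<open>0 < c\<close>
      by (intro mult_left_mono powr_mono) (auto simp: algebra_simps)
    finally show ?thesis by (simp add: N_def)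
  qed
qed

end

subsection \<open>Almost every point has good return times\<close>

text \<open>Allows the targets to be altered at index 0.\<close>

lemma correlation_sum_cong:
  assumes "\<And>n. 1 \<le> n \<Longrightarrow> u n = v n"
  shows "correlation_sum u N = correlation_sum v N"
  unfolding correlation_sum_def
  by (intro arg_cong2[where f = "(+)"] arg_cong2[where f = "(*)"] sum.cong refl arg_cong[where f = abs])
     (simp_all add: assms)

text \<open>\<open>\<sigma>\<close>, \<open>W\<close> and \<open>p\<close> are obtained before
  \<open>y\<close>, so that they are common to almost all points.\<close>

lemma AE_good_point:
  fixes Y :: "'a measure" and S :: "'a \<Rightarrow> 'a" and E :: "nat \<Rightarrow> 'a set"
    and \<rho> :: "nat \<Rightarrow> real" and a c :: real
  assumes sys: "measure_preserving_system Y S"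
    and E: "\<And>n. n \<ge> 1 \<Longrightarrow> E n \<in> sets Y"
    and decay: "decay_of_correlation Y S E \<rho>"
    and \<rho>_nonneg: "\<And>n. n \<ge> 1 \<Longrightarrow> 0 \<le> \<rho> n"
    and \<rho>_dec: "antimono_on {1..} \<rho>"
    and \<rho>_sum: "summable (\<lambda>n. \<rho> (Suc n))"
    and a: "0 < a" "a < 1 / 2" and c: "0 < c"
    and measure_E: "\<And>n. n \<ge> 1 \<Longrightarrow> measure Y (E n) = c * real n powr (- a)"
  obtains \<sigma> W p where "AE y in Y. good_point S E y \<sigma> W p"
proof -
  obtain C where C: "0 < C" and C_decay: "\<forall>n\<ge>1. \<forall>m\<ge>1. \<forall>g :: 'a \<Rightarrow> real. integrable Y g \<longrightarrow>
      (AE y in Y. y \<notin> (\<Union>k\<in>{1..}. E k) \<longrightarrow> g y = 0) \<longrightarrow>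
      \<bar>(LINT y:E n|Y. g ((S ^^ m) y)) - measure Y (E n) * (LINT y|Y. g y)\<bar> \<le> C * \<rho> m * (LINT y|Y. \<bar>g y\<bar>)"
    using decay unfolding decay_of_correlation_def by blast
  define \<sigma> where "\<sigma> n = c * real n powr (- a)" for n
  \<comment> \<open>\<open>E 0\<close> need not be measurable\<close>
  define E' where "E' n = (if n = 0 then {} else E n)" for n
  have E'_eq: "E' n = E n" if "1 \<le> n" for n using that by (simp add: E'_def)
  have Un: "(\<Union>k\<in>{1..}. E' k) = (\<Union>k\<in>{1..}. E k)" by (intro SUP_cong refl E'_eq) simp
  interpret D: decaying_targets Y S E' \<rho> \<sigma> C "\<Sum>n. \<rho> (Suc n)"
  proof unfold_locales
    show "measure_preserving_system Y S" by (rule sys)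
    show "E' n \<in> sets Y" for n using E[of n] by (auto simp: E'_def)
    show "\<bar>(LINT y:E' n|Y. g ((S ^^ m) y)) - measure Y (E' n) * (LINT y|Y. g y)\<bar> \<le> C * \<rho> m * (LINT y|Y. \<bar>g y\<bar>)"
      if "1 \<le> n" "1 \<le> m" "integrable Y g" "AE y in Y. y \<notin> (\<Union>k\<in>{1..}. E' k) \<longrightarrow> g y = 0" for n m g
      using C_decay that unfolding Un E'_eq[OF that(1)] by blast
    show "\<rho> n \<le> \<rho> m" if "1 \<le> m" "m \<le> n" for m n
      using \<rho>_dec that by (auto simp: monotone_on_def)
    show "(\<Sum>n=1..N. \<rho> n) \<le> (\<Sum>n. \<rho> (Suc n))" for N
    proof -
      have "(\<Sum>n=1..N. \<rho> n) = (\<Sum>n<N. \<rho> (Suc n))"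
        by (rule sum.reindex_bij_witness[of _ Suc "\<lambda>n. n - 1"]) auto
      also have "\<dots> \<le> (\<Sum>n. \<rho> (Suc n))" by (rule sum_le_suminf[OF \<rho>_sum]) (auto intro!: \<rho>_nonneg)
      finally show ?thesis .
    qed
    show "measure Y (E' n) = \<sigma> n" if "1 \<le> n" for n
      using measure_E[OF that] by (simp add: E'_eq[OF that] \<sigma>_def)
    show "0 < \<sigma> n" if "1 \<le> n" for n using that c by (simp add: \<sigma>_def)
    show "\<sigma> n \<le> \<sigma> m" if "1 \<le> m" "m \<le> n" for m n
      unfolding \<sigma>_def using that a c by (intro mult_left_mono powr_mono2') auto
  qed (use C \<rho>_nonneg in auto)
  have W_ge: "c * real N powr (1 - a) \<le> D.W N" if "1 \<le> N" for N
  proof -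
    have "c * real N powr (1 - a) = (\<Sum>n=1..N. \<sigma> N)"
      using that by (simp add: \<sigma>_def powr_diff powr_minus field_simps)
    also have "\<dots> \<le> D.W N" unfolding D.W_def by (intro sum_mono D.\<sigma>_dec) auto
    finally show ?thesis .
  qed
  \<comment> \<open>As \<open>a < 1 / 2\<close>, the exponent \<open>1 - a\<close> exceeds
    \<open>1 / 2\<close>, and comparison with a square root gives divergence.\<close>
  have W_top: "filterlim D.W at_top sequentially"
  proof (rule filterlim_at_top_mono)
    show "filterlim (\<lambda>N. c * sqrt (real N)) at_top sequentially"
      by (rule filterlim_tendsto_pos_mult_at_top[OF tendsto_const c
            filterlim_compose[OF sqrt_at_top filterlim_real_sequentially]])
    show "eventually (\<lambda>N. c * sqrt (real N) \<le> D.W N) sequentially"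
      using eventually_ge_at_top[of 1]
    proof eventually_elim
      case (elim N)
      have "c * sqrt (real N) = c * real N powr (1 / 2)" by (simp add: powr_half_sqrt)
      also have "\<dots> \<le> c * real N powr (1 - a)"
        using elim a c by (intro mult_left_mono powr_mono) auto
      also have "\<dots> \<le> D.W N" by (rule W_ge[OF elim])
      finally show ?case .
    qed
  qed
  obtain q :: nat where q: "2 / (1 / 2 - a) \<le> real q" using real_arch_simple by blast
  \<comment> \<open>The successor ensures \<open>1 \<le> p\<close> and preserves the lower bound on
    \<open>q\<close>.\<close>
  define p where "p = Suc q"
  have p: "2 \<le> real p * (1 / 2 - a)" "1 \<le> p"
    using q a by (simp_all add: p_def field_simps)
  have "AE y in Y. summable (\<lambda>k. correlation_sum (\<lambda>n. D.Z n y) (k ^ p) / (D.W (k ^ p))\<^sup>2)"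
    by (rule D.AE_summable_correlations[OF _ c p(2,1)]) (rule W_ge)
  then have "AE y in Y. good_point S E y \<sigma> D.W p"
  proof eventually_elim
    case (elim y)
    have "correlation_sum (\<lambda>n. D.Z n y) N
        = correlation_sum (\<lambda>n. indicator (E n) ((S ^^ n) y) - \<sigma> n) N" for N
      by (rule correlation_sum_cong) (simp add: D.Z_def D.X_def E'_eq)
    with elim show ?case
      by unfold_locales (use p(2) in \<open>auto simp: D.\<sigma>_pos D.\<sigma>_dec D.W_def W_top\<close>)
  qed
  then show ?thesis by (rule that)
qed

(* G is a set of full measure that does not depend on the type 'b, so one null set of points y
   serves all systems (M, T), whatever the type of their points. *)

theorem theorem1:
  fixes Y :: "'a measure" and S :: "'a \<Rightarrow> 'a" and E :: "nat \<Rightarrow> 'a set"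
    and \<rho> :: "nat \<Rightarrow> real" and a c :: real
  assumes "measure_preserving_system Y S"
    and "\<And>n. n \<ge> 1 \<Longrightarrow> E n \<in> sets Y"
    and "decay_of_correlation Y S E \<rho>"
    and "\<And>n. n \<ge> 1 \<Longrightarrow> 0 \<le> \<rho> n"
    and "antimono_on {1..} \<rho>"
    and "summable (\<lambda>n. \<rho> (Suc n))"
    and "0 < a" and "a < 1 / 2" and "0 < c"
    and "\<And>n. n \<ge> 1 \<Longrightarrow> measure Y (E n) = c * real n powr (- a)"
  shows "let G = {y \<in> space Y. infinite (hitting_times S E y) \<and>
                    pointwise_universally_good TYPE(nat \<Rightarrow> real) 2 (return_time S E y) \<and>
                    ergodic_sequence TYPE(nat \<Rightarrow> real) (return_time S E y)}
         in (AE y in Y. y \<in> G) \<and>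
            (\<forall>y\<in>G.
               pointwise_universally_good TYPE('b) 2 (return_time S E y) \<and>
               ergodic_sequence TYPE('b) (return_time S E y) \<and>
               (\<forall>(M :: 'b measure) T f. measure_preserving_system M T \<longrightarrow> Lp_fun M 2 f \<longrightarrow>
                  (AE x in M. (\<lambda>N. ergodic_average T f (return_time S E y) N x)
                     \<longlonglongrightarrow> real_cond_exp M (invariant_algebra M T) f x)))"
  unfolding Let_def
proof (intro conjI ballI)
  obtain \<sigma> W p where "AE y in Y. good_point S E y \<sigma> W p"
    using AE_good_point[OF assms] .
  then show "AE y in Y. y \<in> {y \<in> space Y. infinite (hitting_times S E y) \<and>
      pointwise_universally_good TYPE(nat \<Rightarrow> real) 2 (return_time S E y) \<and>
      ergodic_sequence TYPE(nat \<Rightarrow> real) (return_time S E y)}"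
    using AE_space
  proof eventually_elim
    case (elim y)
    then interpret good_point S E y \<sigma> W p by simp
    have "pointwise_universally_good TYPE(nat \<Rightarrow> real) 2 (return_time S E y)"
      "ergodic_sequence TYPE(nat \<Rightarrow> real) (return_time S E y)"
      by (rule universally_good_of_AE_limit, rule AE_return_time_average, assumption, assumption)+
    with elim infinite_hitting_times show ?case by simp
  qed
next
  fix y assume y: "y \<in> {y \<in> space Y. infinite (hitting_times S E y) \<and>
      pointwise_universally_good TYPE(nat \<Rightarrow> real) 2 (return_time S E y) \<and>
      ergodic_sequence TYPE(nat \<Rightarrow> real) (return_time S E y)}"
  \<comment> \<open>Membership in the set concerns only systems on real sequences; the orbit factor
    carries the limit to type \<open>'b\<close>.\<close>
  have lim: "AE x in M. (\<lambda>N. ergodic_average T f (return_time S E y) N x)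
      \<longlonglongrightarrow> real_cond_exp M (invariant_algebra M T) f x"
    if sys: "measure_preserving_system M T" and f: "Lp_fun M 2 f" for M :: "'b measure" and T f
  proof -
    interpret mp_system M T by unfold_locales (rule sys)
    show ?thesis using y f by (intro AE_average_transfer) auto
  qed
  show "pointwise_universally_good TYPE('b) 2 (return_time S E y)"
    "ergodic_sequence TYPE('b) (return_time S E y)"
    using universally_good_of_AE_limit[OF lim] by blast+
  show "\<forall>(M :: 'b measure) T f. measure_preserving_system M T \<longrightarrow> Lp_fun M 2 f \<longrightarrow>
      (AE x in M. (\<lambda>N. ergodic_average T f (return_time S E y) N x)
        \<longlonglongrightarrow> real_cond_exp M (invariant_algebra M T) f x)"
    using lim by blast
qed

end
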